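(* Let $p$ be a hyperbolic polynomial of degree $\vartheta$ with hyperbolicity cone $K$, let $F=-\ln p$, let $x\in\operatorname{int}(K)$, $s\in\operatorname{int}(K^* )$ and let $\delta_P:=x-\mu\tilde x$. There exist $\vartheta$ points $r_1,\ldots,r_\vartheta$ in $[0,1]$ and associated weights $w_1,\ldots,w_\vartheta$ such that, if $q$ is a univariate polynomial of degree less than $2\vartheta$, then $$\int_0^1\frac{q(t)}{p^2(x-t\delta_P)}\,dt=\sum_{i=1}^\vartheta w_iq(r_i).$$
   Context: A homogeneous polynomial $p$ of degree $\vartheta$ on a finite-dimensional real vector space $\mathbb{E}$ is hyperbolic in direction $e\in\mathbb{E}$ if $p(e)>0$ and for every $x\in\mathbb{E}$ the univariate polynomial $t\mapsto p(x-te)$ has only real roots; its hyperbolicity cone is $K=\{x: \text{all roots of } t\mapsto p(x-te)\text{ are}\ge0\}$, assumed pointed, with interior the set where all roots are positive. $p>0$ on $\operatorname{int}(K)$, and $F=-\ln p$ is a $\vartheta$-logarithmically homogeneous self-concordant barrier for $K$. $K^*:=\{s\in\mathbb{E}^*:\langle s,x\rangle\ge0\ \forall x\in K\}$; $F_*(s):=\sup\{-\langle s,x\rangle-F(x):x\in\operatorname{int}(K)\}$; $\mu:=\langle s,x\rangle/\vartheta$; $\tilde x:=-F_*'(s)\in\operatorname{int}(K)$. $p^2(\cdot)$ means $(p(\cdot))^2$. The nodes and weights may depend on $p,x,\delta_P$ but not on $q$. *)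

theory Defs
  imports "HOL-Analysis.Analysis" "HOL-Computational_Algebra.Polynomial"
begin

text \<open>
  The ambient space is an arbitrary Euclidean space \<open>'a\<close> (only its vector space
  structure and topology are used), and its dual is the space \<open>'a \<Rightarrow>\<^sub>L real\<close> of
  (automatically continuous) linear functionals. A polynomial on \<open>'a\<close> is represented by
  its polynomial function.
\<close>

definition homogeneous_polynomial :: "nat \<Rightarrow> ('a::euclidean_space \<Rightarrow> real) \<Rightarrow> bool" where
  "homogeneous_polynomial d p \<longleftrightarrow>
     real_polynomial_function p \<and> (\<forall>c x. p (c *\<^sub>R x) = c ^ d * p x)"

definition line_poly :: "('a::euclidean_space \<Rightarrow> real) \<Rightarrow> 'a \<Rightarrow> 'a \<Rightarrow> real poly" where
  "line_poly p x e = (THE P. \<forall>t. poly P t = p (x - t *\<^sub>R e))"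

text \<open>``Only real roots'' is a statement about the complex roots of the line restriction.\<close>

definition hyperbolic :: "nat \<Rightarrow> ('a::euclidean_space \<Rightarrow> real) \<Rightarrow> 'a \<Rightarrow> bool" where
  "hyperbolic d p e \<longleftrightarrow>
     homogeneous_polynomial d p \<and> p e > 0 \<and>
     (\<forall>x. \<forall>z::complex. poly (map_poly complex_of_real (line_poly p x e)) z = 0 \<longrightarrow> z \<in> \<real>)"

definition hyperbolicity_cone :: "('a::euclidean_space \<Rightarrow> real) \<Rightarrow> 'a \<Rightarrow> 'a set" where
  "hyperbolicity_cone p e = {x. \<forall>t. poly (line_poly p x e) t = 0 \<longrightarrow> 0 \<le> t}"

definition pointed_cone :: "'a::euclidean_space set \<Rightarrow> bool" where
  "pointed_cone K \<longleftrightarrow> K \<inter> uminus ` K = {0}"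

definition dual_cone :: "'a::euclidean_space set \<Rightarrow> ('a \<Rightarrow>\<^sub>L real) set" where
  "dual_cone K = {s. \<forall>x\<in>K. 0 \<le> blinfun_apply s x}"

definition log_barrier :: "('a::euclidean_space \<Rightarrow> real) \<Rightarrow> 'a \<Rightarrow> real" where
  "log_barrier p x = - ln (p x)"

text \<open>
  A supremum of reals: it is meaningful where the family is bounded above, which for a
  logarithmic barrier of \<open>K\<close> is the case throughout the interior of the dual cone.
\<close>

definition conjugate_barrier ::
    "'a::euclidean_space set \<Rightarrow> ('a \<Rightarrow> real) \<Rightarrow> ('a \<Rightarrow>\<^sub>L real) \<Rightarrow> real" where
  "conjugate_barrier K F s = (SUP x\<in>interior K. - blinfun_apply s x - F x)"

text \<open>
  The derivative at \<open>s\<close> of a function on the dual space, an element of the bidual, is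
  regarded as an element of \<open>'a\<close>.
\<close>

definition dual_gradient ::
    "(('a::euclidean_space \<Rightarrow>\<^sub>L real) \<Rightarrow> real) \<Rightarrow> ('a \<Rightarrow>\<^sub>L real) \<Rightarrow> 'a" where
  "dual_gradient G s = (THE v. (G has_derivative (\<lambda>h. blinfun_apply h v)) (at s))"

lemma poly_eqI_fun:
  fixes P Q :: "real poly"
  assumes "\<forall>t. poly P t = poly Q t"
  shows "P = Q"
proof -
  have "poly P = poly Q" using assms by (intro ext) simp
  then show ?thesis by (simp add: poly_eq_poly_eq_iff)
qed

lemma line_restriction_exists:
  assumes "real_polynomial_function p"
  shows "\<exists>P. \<forall>t. poly P t = p (x - t *\<^sub>R e)"
  using assms
proof (induction rule: real_polynomial_function.induct)
  case (linear f)
  then interpret bounded_linear f .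
  have "\<forall>t. poly [:f x, - f e:] t = f (x - t *\<^sub>R e)"
    by (simp add: diff scale)
  then show ?case by blast
next
  case (const c)
  have "\<forall>t. poly [:c:] t = c" by simp
  then show ?case by blast
next
  case (add f g)
  then obtain P Q where "\<forall>t. poly P t = f (x - t *\<^sub>R e)" "\<forall>t. poly Q t = g (x - t *\<^sub>R e)"
    by blast
  then have "\<forall>t. poly (P + Q) t = f (x - t *\<^sub>R e) + g (x - t *\<^sub>R e)" by simp
  then show ?case by (rule exI)
next
  case (mult f g)
  then obtain P Q where "\<forall>t. poly P t = f (x - t *\<^sub>R e)" "\<forall>t. poly Q t = g (x - t *\<^sub>R e)"
    by blast
  then have "\<forall>t. poly (P * Q) t = f (x - t *\<^sub>R e) * g (x - t *\<^sub>R e)" by simp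
  then show ?case by (rule exI)
qed

lemma poly_line_poly:
  assumes "real_polynomial_function p"
  shows "poly (line_poly p x e) t = p (x - t *\<^sub>R e)"
proof -
  obtain P where P: "\<forall>t. poly P t = p (x - t *\<^sub>R e)"
    using line_restriction_exists[OF assms] by blast
  have "\<exists>!P. \<forall>t. poly P t = p (x - t *\<^sub>R e)"
  proof (rule ex1I[of _ P])
    fix Q assume "\<forall>t. poly Q t = p (x - t *\<^sub>R e)"
    with P show "Q = P" by (intro poly_eqI_fun) simp
  qed (rule P)
  from theI'[OF this] show ?thesis by (simp add: line_poly_def)
qed

lemma linear_functional_on_dual:
  fixes L :: "('a::euclidean_space \<Rightarrow>\<^sub>L real) \<Rightarrow> real"
  assumes "linear L"
  shows "\<exists>v. \<forall>h. L h = blinfun_apply h v"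
proof -
  let ?v = "\<Sum>b\<in>Basis. L (blinfun_inner_right b) *\<^sub>R b"
  have "L h = blinfun_apply h ?v" for h
  proof -
    have "h = (\<Sum>b\<in>Basis. blinfun_apply h b *\<^sub>R blinfun_inner_right b)"
    proof (rule blinfun_eqI)
      fix x :: 'a
      have "blinfun_apply h x = blinfun_apply h (\<Sum>b\<in>Basis. (x \<bullet> b) *\<^sub>R b)"
        by (simp only: euclidean_representation)
      also have "\<dots> = (\<Sum>b\<in>Basis. blinfun_apply h b * (b \<bullet> x))"
        unfolding blinfun.sum_right blinfun.scaleR_right
        by (intro sum.cong) (simp_all add: inner_commute)
      also have "\<dots> = blinfun_apply (\<Sum>b\<in>Basis. blinfun_apply h b *\<^sub>R blinfun_inner_right b) x"
        unfolding blinfun.sum_left blinfun.scaleR_left by simp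
      finally show "blinfun_apply h x =
          blinfun_apply (\<Sum>b\<in>Basis. blinfun_apply h b *\<^sub>R blinfun_inner_right b) x" .
    qed
    then have "L h = L (\<Sum>b\<in>Basis. blinfun_apply h b *\<^sub>R blinfun_inner_right b)" by (rule arg_cong)
    also have "\<dots> = (\<Sum>b\<in>Basis. blinfun_apply h b * L (blinfun_inner_right b))"
      by (simp add: linear_sum[OF assms] linear_scale[OF assms])
    also have "\<dots> = blinfun_apply h ?v"
      unfolding blinfun.sum_right blinfun.scaleR_right
      by (intro sum.cong) simp_all
    finally show ?thesis .
  qed
  then show ?thesis by blast
qed

lemma dual_gradient_eq:
  fixes v :: "'a::euclidean_space"
  assumes "(G has_derivative (\<lambda>h. blinfun_apply h v)) (at s)"
  shows "dual_gradient G s = v"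
  unfolding dual_gradient_def
proof (rule the_equality)
  show "(G has_derivative (\<lambda>h. blinfun_apply h v)) (at s)" by (rule assms)
next
  fix w assume "(G has_derivative (\<lambda>h. blinfun_apply h w)) (at s)"
  from frechet_derivative_at[OF this] frechet_derivative_at[OF assms]
  have "(\<lambda>h::'a \<Rightarrow>\<^sub>L real. blinfun_apply h v) = (\<lambda>h. blinfun_apply h w)" by simp
  then have "blinfun_apply (blinfun_inner_right b) v = blinfun_apply (blinfun_inner_right b) w"
    for b :: 'a by (drule_tac x = "blinfun_inner_right b" in fun_cong)
  then have "b \<bullet> v = b \<bullet> w" for b :: 'a by simp
  then have "w \<bullet> b = v \<bullet> b" for b :: 'a by (metis inner_commute)
  then show "w = v" by (rule euclidean_eqI)
qed

lemma has_derivative_dual_gradient: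
  assumes "G differentiable (at s)"
  shows "(G has_derivative (\<lambda>h. blinfun_apply h (dual_gradient G s))) (at s)"
proof -
  obtain L where L: "(G has_derivative L) (at s)"
    using assms by (auto simp: differentiable_def)
  obtain v where "\<forall>h. L h = blinfun_apply h v"
    using linear_functional_on_dual[OF has_derivative_linear[OF L]] by blast
  then have "L = (\<lambda>h. blinfun_apply h v)" by (intro ext) simp
  with L have v: "(G has_derivative (\<lambda>h. blinfun_apply h v)) (at s)" by simp
  show ?thesis unfolding dual_gradient_eq[OF v] by (rule v)
qed

end

theory Submission
  imports Defs "HOL-Computational_Algebra.Fundamental_Theorem_Algebra"
begin

text \<open>
  The quadrature is Gaussian quadrature for the weight \<open>1 / p(x - t \<delta>)\<^sup>2\<close>, so all that is needed is
  that this weight is continuous on \<open>[0, 1]\<close>, i.e. that the segment from \<open>x\<close> to \<open>\<mu> xt\<close> stays in the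
  interior of \<open>K\<close>. Convexity of the interior is Garding's theorem, proved by deforming univariate
  restrictions of the complexified polynomial while keeping their roots off the boundary of a half-plane.
  The same theorem makes \<open>p\<close> real-rooted along every line through an interior point, hence \<open>ln p\<close>
  concave there, and strictly so transversally to lines on which \<open>p\<close> is constant. Therefore
  \<open>ln p - s\<close> has a unique maximizer on the interior, and the conjugate barrier is
  differentiable at \<open>s\<close> with minus this maximizer as gradient (Danskin's argument).
\<close>

subsection \<open>Gaussian quadrature\<close>

text \<open>The obstacle in Garding's theorem is that real roots in direction \<open>e\<close> say
  nothing directly about another direction \<open>y\<close>. The complex span of \<open>x\<close>,
  \<open>y\<close>, \<open>e\<close> turns this around: with real coefficients at \<open>x\<close>
  and \<open>y\<close>, a nonreal coefficient at \<open>e\<close> excludes a zero, so an imaginary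
  shift along \<open>e\<close> keeps the roots in direction \<open>y\<close> off the real axis.
  Homogeneity fixes the degree and leading coefficient in that direction as \<open>d\<close> and
  \<open>p y\<close>, so no root escapes to infinity during a deformation. On a segment in the cone,
  \<open>ln p\<close> becomes a constant plus a sum of logarithms of affine functions, one per root.
  The remaining input is coercivity: since \<open>s\<close> is interior to the dual cone, it
  dominates a positive multiple of the norm on \<open>K\<close>. This one bound yields existence of
  the maximizer, rules out lines in the cone on which both \<open>p\<close> and \<open>s\<close> are
  constant (hence uniqueness), and makes \<open>mu\<close> positive.\<close>

lemma sign_correcting_factor:
  fixes q :: "real poly"
  assumes "q \<noteq> 0"
  shows "\<exists>S. finite S \<and> S \<subseteq> {a..b} \<and> (\<Prod>r\<in>S. [:-r, 1:]) dvd q \<and>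
     ((\<forall>t\<in>{a..b}. 0 \<le> poly (q * (\<Prod>r\<in>S. [:-r, 1:])) t) \<or>
      (\<forall>t\<in>{a..b}. poly (q * (\<Prod>r\<in>S. [:-r, 1:])) t \<le> 0))"
  using assms
proof (induction "degree q" arbitrary: q rule: less_induct)
  case less
  show ?case
  proof (cases "(\<forall>t\<in>{a..b}. 0 \<le> poly q t) \<or> (\<forall>t\<in>{a..b}. poly q t \<le> 0)")
    case True
    then show ?thesis by (intro exI[of _ "{}"]) auto
  next
    case False
    then obtain u v where uv: "u \<in> {a..b}" "v \<in> {a..b}" "poly q u < 0" "0 < poly q v"
      by (meson not_le)
    have "connected (poly q ` {a..b})"
      by (intro connected_continuous_image continuous_intros) auto
    then have "0 \<in> poly q ` {a..b}"
      using uv by (meson connectedD_interval image_eqI less_imp_le)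
    then obtain r where r: "r \<in> {a..b}" "poly q r = 0" by auto
    then obtain q' where q': "q = [:-r, 1:] * q'" by (metis dvdE poly_eq_0_iff_dvd)
    with less.prems have "q' \<noteq> 0" by auto
    then have "degree q = Suc (degree q')" unfolding q' by (subst degree_mult_eq) auto
    with less.hyps[of q'] \<open>q' \<noteq> 0\<close> obtain S where
      S: "finite S" "S \<subseteq> {a..b}" "(\<Prod>r\<in>S. [:-r, 1:]) dvd q'" and
      sgn: "(\<forall>t\<in>{a..b}. 0 \<le> poly (q' * (\<Prod>r\<in>S. [:-r, 1:])) t) \<or>
        (\<forall>t\<in>{a..b}. poly (q' * (\<Prod>r\<in>S. [:-r, 1:])) t \<le> 0)" by auto
    show ?thesis
    \<comment> \<open>Splitting off \<open>r\<close> flips the parity of its multiplicity, so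
      \<open>r\<close> is toggled in \<open>S\<close>: removing it leaves the corrected product
      unchanged, inserting it contributes the harmless square of \<open>t - r\<close>.\<close>
    proof (cases "r \<in> S")
      case True
      have *: "(\<Prod>r\<in>S. [:-r, 1:]) = [:-r, 1:] * (\<Prod>r\<in>S - {r}. [:-r, 1:])"
        using S True by (subst prod.remove[of _ r]) auto
      have "q * (\<Prod>r\<in>S - {r}. [:-r, 1:]) = q' * (\<Prod>r\<in>S. [:-r, 1:])"
        unfolding * q' by (simp only: mult.assoc mult.left_commute)
      moreover have "(\<Prod>r\<in>S - {r}. [:-r, 1:]) dvd q"
        using S(3) unfolding * q' by (meson dvd_mult dvd_mult_right)
      ultimately show ?thesis
        using S sgn by (intro exI[of _ "S - {r}"]) auto
    next
      case False
      then have *: "(\<Prod>r\<in>insert r S. [:-r, 1:]) = [:-r, 1:] * (\<Prod>r\<in>S. [:-r, 1:])"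
        using S by auto
      have "poly (q * (\<Prod>r\<in>insert r S. [:-r, 1:])) t =
          (t - r)\<^sup>2 * poly (q' * (\<Prod>r\<in>S. [:-r, 1:])) t" for t
        unfolding * q' poly_mult by (simp add: power2_eq_square algebra_simps)
      moreover have "(\<Prod>r\<in>insert r S. [:-r, 1:]) dvd q"
        unfolding * q' using S(3) by (rule mult_dvd_mono[OF dvd_refl])
      ultimately show ?thesis
        using S r sgn
        by (intro exI[of _ "insert r S"])
           (auto simp: mult_nonneg_nonpos simp del: prod.insert poly_mult)
    qed
  qed
qed

lemma lagrange_interpolation:
  fixes q :: "'a::field poly"
  assumes "finite S" "degree q < card S"
  shows "q = (\<Sum>r\<in>S. smult (poly q r) (\<Prod>u\<in>S - {r}. smult (inverse (r - u)) [:-u, 1:]))"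
    (is "q = ?R")
proof (rule ccontr)
  assume ne: "q \<noteq> ?R"
  have val: "poly (\<Prod>u\<in>S - {r}. smult (inverse (r - u)) [:-u, 1:]) x = (if x = r then 1 else 0)"
    if "r \<in> S" "x \<in> S" for r x
  proof (cases "x = r")
    case True
    have "poly (smult (inverse (r - u)) [:-u, 1:]) r = 1" if "u \<in> S - {r}" for u
    proof -
      have "poly (smult (inverse (r - u)) [:-u, 1:]) r = inverse (r - u) * (r - u)"
        by (simp add: algebra_simps)
      also have "\<dots> = 1" using that by (intro left_inverse) auto
      finally show ?thesis .
    qed
    then show ?thesis using True by (simp add: poly_prod del: poly_smult)
  next
    case False
    then show ?thesis using that assms(1) by (auto simp: poly_prod)
  qed
  have "degree (smult (poly q r) (\<Prod>u\<in>S - {r}. smult (inverse (r - u)) [:-u, 1:])) < card S"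
    if "r \<in> S" for r
  proof -
    have "degree (\<Prod>u\<in>S - {r}. smult (inverse (r - u)) [:-u, 1:])
        \<le> (\<Sum>u\<in>S - {r}. degree (smult (inverse (r - u)) [:-u, 1:]))"
      using assms(1) degree_prod_sum_le[of "S - {r}" "\<lambda>u. smult (inverse (r - u)) [:-u, 1:]"]
      by (simp add: o_def)
    also have "\<dots> \<le> (\<Sum>u\<in>S - {r}. 1)"
      by (intro sum_mono order_trans[OF degree_smult_le]) simp
    also have "\<dots> < card S" using that assms(1) by (simp only: card_Diff1_less flip: card_eq_sum)
    finally show ?thesis using degree_smult_le le_less_trans by blast
  qed
  moreover have "0 < card S" using assms(2) by simp
  ultimately have "degree ?R < card S" by (intro degree_sum_less) auto
  then have deg: "degree (q - ?R) < card S" using assms(2) degree_diff_less by blast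
  have "S \<subseteq> {x. poly (q - ?R) x = 0}"
  proof
    fix x assume "x \<in> S"
    then have "poly ?R x = (\<Sum>r\<in>S. if x = r then poly q r else 0)"
      unfolding poly_sum by (intro sum.cong refl) (simp only: poly_smult val, simp)
    then show "x \<in> {x. poly (q - ?R) x = 0}" using assms(1) \<open>x \<in> S\<close> by simp
  qed
  then have "card S \<le> card {x. poly (q - ?R) x = 0}"
    using ne by (intro card_mono poly_roots_finite) simp_all
  also have "\<dots> \<le> degree (q - ?R)"
    using ne by (intro card_poly_roots_bound) simp
  finally have "card S \<le> degree (q - ?R)" .
  with deg show False by simp
qed

text \<open>Abstracts integration against a positive weight. Strict positivity makes
  \<open>L (f * g)\<close> an inner product on polynomials and is also what forces the nodes into
  the interval.\<close>

locale positive_poly_functional =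
  fixes L :: "real poly \<Rightarrow> real" and a b :: real
  assumes add: "L (f + g) = L f + L g"
    and smult: "L (smult c f) = c * L f"
    and pos: "f \<noteq> 0 \<Longrightarrow> (\<And>t. t \<in> {a..b} \<Longrightarrow> 0 \<le> poly f t) \<Longrightarrow> 0 < L f"
begin

lemma zero: "L 0 = 0"
  using smult[of 0 0] by simp

lemma diff: "L (f - g) = L f - L g"
  using add[of f "- g"] smult[of "-1" g] by simp

lemma sum: "L (\<Sum>i\<in>I. f i) = (\<Sum>i\<in>I. L (f i))"
  by (induction I rule: infinite_finite_induct) (simp_all add: zero add)

lemma pos_square: "f \<noteq> 0 \<Longrightarrow> 0 < L (f * f)"
  by (rule pos) auto

text \<open>Gram-Schmidt, one degree at a time. The condition on coefficients stands for degree
  below \<open>n\<close>; unlike \<open>degree g < n\<close> it still admits the zero polynomial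
  when \<open>n = 0\<close>.\<close>

lemma orthogonal_projection:
  "\<exists>g. (\<forall>j\<ge>n. coeff g j = 0) \<and> (\<forall>q. (\<forall>j\<ge>n. coeff q j = 0) \<longrightarrow> L ((f - g) * q) = 0)"
proof (induction n arbitrary: f)
  case 0
  have "L (f * q) = 0" if "\<forall>j. coeff q j = 0" for q
  proof -
    have "q = 0" using that by (simp add: poly_eq_iff)
    then show ?thesis by (simp add: zero)
  qed
  then show ?case by (intro exI[of _ 0]) simp
next
  case (Suc n)
  obtain h where h: "\<forall>j\<ge>n. coeff h j = 0"
    "\<forall>q. (\<forall>j\<ge>n. coeff q j = 0) \<longrightarrow> L ((monom 1 n - h) * q) = 0"
    using Suc.IH by blast
  obtain g where g: "\<forall>j\<ge>n. coeff g j = 0"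
    "\<forall>q. (\<forall>j\<ge>n. coeff q j = 0) \<longrightarrow> L ((f - g) * q) = 0"
    using Suc.IH by blast
  define E where "E = monom 1 n - h"
  have En: "coeff E n = 1" "\<forall>j>n. coeff E j = 0" using h(1) by (auto simp: E_def)
  then have "E \<noteq> 0" by auto
  then have EE: "L (E * E) > 0" by (rule pos_square)
  \<comment> \<open>The Fourier coefficient of \<open>f - g\<close> along \<open>E\<close>. As
    \<open>E\<close> is monic of degree \<open>n\<close>, a test polynomial splits into a part below
    degree \<open>n\<close>, already orthogonal to \<open>f - g\<close> and to \<open>E\<close>, and
    a multiple of \<open>E\<close>, for which \<open>c\<close> is chosen.\<close>
  define c where "c = L ((f - g) * E) / L (E * E)"
  have "L ((f - (g + smult c E)) * q) = 0" if q: "\<forall>j\<ge>Suc n. coeff q j = 0" for q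
  proof -
    define q' where "q' = q - smult (coeff q n) E"
    have q': "\<forall>j\<ge>n. coeff q' j = 0"
    proof (intro allI impI)
      fix j assume "n \<le> j"
      then show "coeff q' j = 0" using q En by (cases "j = n") (auto simp: q'_def)
    qed
    have "(f - (g + smult c E)) * q =
        (f - g) * q' + smult (coeff q n) ((f - g) * E) - smult c (E * q')
          - smult (c * coeff q n) (E * E)"
      by (simp add: q'_def algebra_simps smult_diff_right smult_add_right)
    moreover have "L (E * q') = 0" using h(2) q' by (simp add: E_def)
    ultimately have "L ((f - (g + smult c E)) * q) =
        coeff q n * L ((f - g) * E) - c * coeff q n * L (E * E)"
      using g(2) q' by (simp add: add diff smult)
    then show ?thesis using EE by (simp add: c_def)
  qed
  moreover have "\<forall>j\<ge>Suc n. coeff (g + smult c E) j = 0" using g(1) En by auto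
  ultimately show ?case by blast
qed

text \<open>If the sign-correcting factor \<open>g\<close> of the orthogonal polynomial
  \<open>E\<close> had degree below \<open>n\<close>, orthogonality would give
  \<open>L (E * g) = 0\<close>, although \<open>E * g\<close> is nonzero and of one sign on the
  interval. So \<open>g\<close> has full degree and, dividing \<open>E\<close>, equals it up to a
  constant: the roots are simple and lie in the interval.\<close>

lemma orthogonal_split_poly:
  "\<exists>S. finite S \<and> card S = n \<and> S \<subseteq> {a..b} \<and> (\<forall>q. degree q < n \<longrightarrow> L ((\<Prod>r\<in>S. [:-r, 1:]) * q) = 0)"
proof -
  obtain h where h: "\<forall>j\<ge>n. coeff h j = 0"
    "\<forall>q. (\<forall>j\<ge>n. coeff q j = 0) \<longrightarrow> L ((monom 1 n - h) * q) = 0"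
    using orthogonal_projection by blast
  define E where "E = monom 1 n - h"
  have En: "coeff E n = 1" "\<forall>j>n. coeff E j = 0" using h(1) by (auto simp: E_def)
  then have E0: "E \<noteq> 0" by auto
  have degE: "degree E = n"
    using En by (metis coeff_0_degree_minus_1 degree_le le_degree leD le_antisym zero_neq_one)
  obtain S where S: "finite S" "S \<subseteq> {a..b}" "(\<Prod>r\<in>S. [:-r, 1:]) dvd E" and
    sgn: "(\<forall>t\<in>{a..b}. 0 \<le> poly (E * (\<Prod>r\<in>S. [:-r, 1:])) t) \<or>
        (\<forall>t\<in>{a..b}. poly (E * (\<Prod>r\<in>S. [:-r, 1:])) t \<le> 0)"
    using sign_correcting_factor[OF E0, of a b] by (elim exE conjE) (rule that)
  define g where "g = (\<Prod>r\<in>S. [:-r, 1:])"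
  have g0: "g \<noteq> 0" using S(1) by (auto simp: g_def)
  have degg: "degree g = card S" unfolding g_def using S(1) by (subst degree_prod_eq_sum_degree) auto
  have "L (E * g) \<noteq> 0"
    using sgn
  proof
    assume "\<forall>t\<in>{a..b}. 0 \<le> poly (E * (\<Prod>r\<in>S. [:-r, 1:])) t"
    then have "0 < L (E * g)" using E0 g0 by (intro pos) (auto simp: g_def)
    then show ?thesis by simp
  next
    assume "\<forall>t\<in>{a..b}. poly (E * (\<Prod>r\<in>S. [:-r, 1:])) t \<le> 0"
    then have "0 < L (smult (-1) (E * g))" using E0 g0 by (intro pos) (auto simp: g_def)
    then show ?thesis by (simp only: smult)
  qed
  then have "\<not> card S < n"
    using h(2) degg by (metis E_def coeff_eq_0 order_less_le_trans)
  moreover obtain k where k: "E = g * k" using S(3) by (auto simp: g_def dvd_def)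
  moreover from this E0 have "degree E = degree g + degree k" by (auto simp: degree_mult_eq)
  ultimately have "card S = n" "degree k = 0" using degE degg by auto
  then obtain c where c: "k = [:c:]" by (metis degree_eq_zeroE)
  with k E0 have "c \<noteq> 0" "E = smult c g" by auto
  have "L (g * q) = 0" if "degree q < n" for q
  proof -
    have "L (E * q) = 0" using h(2) that by (simp add: E_def coeff_eq_0)
    then show ?thesis using \<open>c \<noteq> 0\<close> by (simp add: \<open>E = smult c g\<close> smult)
  qed
  with S \<open>card S = n\<close> show ?thesis unfolding g_def by blast
qed

text \<open>Divide \<open>q\<close> by the node polynomial \<open>g\<close>. Quotient and remainder
  both have degree below \<open>n\<close>; orthogonality annihilates the quotient part, and the
  remainder agrees with \<open>q\<close> at the nodes and is recovered by interpolation
  there.\<close>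

lemma gauss_quadrature:
  "\<exists>r w :: nat \<Rightarrow> real. (\<forall>i\<in>{1..n}. r i \<in> {a..b}) \<and>
     (\<forall>q. degree q < 2 * n \<longrightarrow> L q = (\<Sum>i=1..n. w i * poly q (r i)))"
proof -
  obtain S where S: "finite S" "card S = n" "S \<subseteq> {a..b}"
    and orth: "\<And>q. degree q < n \<Longrightarrow> L ((\<Prod>r\<in>S. [:-r, 1:]) * q) = 0"
    using orthogonal_split_poly by blast
  define g where "g = (\<Prod>r\<in>S. [:-r, 1:])"
  have g0: "g \<noteq> 0" using S(1) by (auto simp: g_def)
  have degg: "degree g = n"
    unfolding g_def using S(1,2) by (subst degree_prod_eq_sum_degree) auto
  obtain r where r: "bij_betw r {1..n} S"
    using ex_bij_betw_nat_finite_1[OF S(1)] S(2) by auto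
  define W where "W x = L (\<Prod>u\<in>S - {x}. smult (inverse (x - u)) [:-u, 1:])" for x
  have "L q = (\<Sum>i=1..n. W (r i) * poly q (r i))" if q: "degree q < 2 * n" for q
  proof -
    have "n > 0" using q by simp
    define c where "c = q mod g"
    have degc: "degree c < n"
      unfolding c_def using degree_mod_less'[OF g0, of q] degg \<open>n > 0\<close>
      by (metis degree_0 degree_mod_less g0)
    have degd: "degree (q div g) < n"
    proof (cases "q div g = 0")
      case False
      have "degree (q div g * g) \<le> max (degree q) (degree c)"
        using degree_diff_le_max[of q c] by (simp add: c_def minus_mod_eq_div_mult)
      then show ?thesis using False g0 degg degc q by (simp add: degree_mult_eq)
    qed (use \<open>n > 0\<close> in simp)
    have "L q = L (g * (q div g)) + L c"
      unfolding c_def by (simp flip: add)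
    also have "\<dots> = L c" using orth[OF degd] by (simp add: g_def)
    also have "\<dots> = (\<Sum>x\<in>S. poly c x * W x)"
      using degc S(2) by (subst lagrange_interpolation[OF S(1), of c]) (auto simp: sum smult W_def)
    also have "\<dots> = (\<Sum>x\<in>S. W x * poly q x)"
    proof (intro sum.cong refl)
      fix x assume "x \<in> S"
      then have "poly g x = 0" using S(1) by (auto simp: g_def poly_prod)
      then have "poly q x = poly c x"
        unfolding c_def by (metis poly_add poly_mult mult_div_mod_eq mult_zero_left add_0)
      then show "poly c x * W x = W x * poly q x" by simp
    qed
    also have "\<dots> = (\<Sum>i=1..n. W (r i) * poly q (r i))"
      using r by (rule sum.reindex_bij_betw[symmetric])
    finally show ?thesis .
  qed
  moreover have "\<forall>i\<in>{1..n}. r i \<in> {a..b}" using r S(3) by (auto simp: bij_betw_def)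
  ultimately show ?thesis by (intro exI[of _ r] exI[of _ "W \<circ> r"]) auto
qed

end

lemma weighted_integral_quadrature:
  fixes f :: "real \<Rightarrow> real"
  assumes ab: "a < b" and cont: "continuous_on {a..b} f"
    and f: "\<And>t. t \<in> {a..b} \<Longrightarrow> 0 < f t"
  shows "\<exists>r w :: nat \<Rightarrow> real. (\<forall>i\<in>{1..n}. r i \<in> {a..b}) \<and>
     (\<forall>q. degree q < 2 * n \<longrightarrow>
       ((\<lambda>t. poly q t * f t) has_integral (\<Sum>i=1..n. w i * poly q (r i))) {a..b})"
proof -
  define L where "L q = integral {a..b} (\<lambda>t. poly q t * f t)" for q
  have cont': "continuous_on {a..b} (\<lambda>t. poly q t * f t)" for q
    by (intro continuous_intros cont)
  have int: "(\<lambda>t. poly q t * f t) integrable_on {a..b}" for q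
    by (rule integrable_continuous_real[OF cont'])
  interpret positive_poly_functional L a b
  proof
    fix g h :: "real poly" and c :: real
    show "L (g + h) = L g + L h"
      unfolding L_def by (simp add: distrib_right integral_add[OF int int])
    show "L (smult c g) = c * L g"
      unfolding L_def by (simp add: mult.assoc)
    assume g: "g \<noteq> 0" "\<And>t. t \<in> {a..b} \<Longrightarrow> 0 \<le> poly g t"
    have "L g \<ge> 0" unfolding L_def
      using g(2) f by (intro integral_nonneg int) (auto simp: less_imp_le)
    moreover have "L g \<noteq> 0"
    proof
      assume "L g = 0"
      then have "\<forall>t\<in>{a..b}. poly g t * f t = 0"
        unfolding L_def
        using integral_eq_0_iff[OF cont' ab, of g] g(2) f by (auto simp: less_imp_le)
      then have "{a..b} \<subseteq> {t. poly g t = 0}" using f by fastforce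
      then show False
        using ab poly_roots_finite[OF g(1)] infinite_Icc[OF ab] finite_subset by blast
    qed
    ultimately show "0 < L g" by simp
  qed
  show ?thesis
    using gauss_quadrature[of n] int by (metis L_def integrable_integral)
qed

subsection \<open>Root continuity and complexification\<close>

lemma poly_map_poly_of_real:
  "poly (map_poly of_real q) (of_real t) = (of_real (poly q t) :: 'a::{comm_semiring_0,real_algebra_1})"
  by (induction q) (simp_all add: map_poly_pCons)

lemma complex_poly_eqI_real:
  fixes Q R :: "complex poly"
  assumes "\<And>t::real. poly Q (of_real t) = poly R (of_real t)"
  shows "Q = R"
proof -
  have "range complex_of_real \<subseteq> {z. poly (Q - R) z = 0}" using assms by auto
  moreover have "infinite (range complex_of_real)"
    by (simp add: finite_image_iff infinite_UNIV_char_0 inj_of_real)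
  ultimately have "Q - R = 0" using finite_subset poly_roots_finite by metis
  then show ?thesis by simp
qed

text \<open>Factor \<open>Q\<close> into linear factors, each of norm at least \<open>\<rho>\<close>
  at \<open>t\<close>. Read contrapositively this is quantitative root continuity: a small value at
  \<open>t\<close> forces a root near \<open>t\<close>, uniformly over polynomials of the same
  degree and leading coefficient.\<close>

lemma norm_poly_ge_root_free_ball:
  fixes Q :: "complex poly"
  assumes "\<And>z. poly Q z = 0 \<Longrightarrow> \<rho> \<le> dist t z" and "0 \<le> \<rho>"
  shows "norm (lead_coeff Q) * \<rho> ^ degree Q \<le> norm (poly Q t)"
  using assms(1)
proof (induction "degree Q" arbitrary: Q)
  case 0
  then obtain c where "Q = [:c:]" by (metis degree_eq_zeroE)
  then show ?case by simp
next
  case (Suc n)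
  then obtain z where z: "poly Q z = 0"
    using fundamental_theorem_of_algebra[of Q] constant_degree by (metis nat.distinct(1))
  then obtain R where R: "Q = [:-z, 1:] * R" by (metis dvdE poly_eq_0_iff_dvd)
  have "R \<noteq> 0" using Suc.hyps(2) R by auto
  then have deg: "degree Q = Suc (degree R)" unfolding R by (subst degree_mult_eq) auto
  have "norm (lead_coeff R) * \<rho> ^ degree R \<le> norm (poly R t)"
    using Suc.hyps(2) deg Suc.prems by (intro Suc.hyps(1)) (auto simp: R)
  moreover have "\<rho> \<le> norm (t - z)" using Suc.prems[OF z] by (simp add: dist_norm)
  ultimately have "\<rho> * (norm (lead_coeff R) * \<rho> ^ degree R) \<le> norm (t - z) * norm (poly R t)"
    using assms(2) by (intro mult_mono) auto
  moreover have "poly Q t = (t - z) * poly R t" unfolding R by (simp add: algebra_simps)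
  moreover have "lead_coeff Q = lead_coeff R" unfolding R by (subst lead_coeff_mult) auto
  ultimately show ?case by (simp add: deg norm_mult mult.left_commute)
qed

text \<open>The set of parameters whose polynomial has a root in \<open>S\<close> is closed because the roots stay
  bounded, and open because a root moves continuously and cannot leave \<open>U\<close> without
  passing through \<open>S - U\<close>.\<close>

lemma root_homotopy:
  fixes Q :: "real \<Rightarrow> complex poly"
  assumes Q: "\<And>\<beta>. \<beta> \<in> {0..1} \<Longrightarrow> degree (Q \<beta>) = n \<and> lead_coeff (Q \<beta>) = l" and l: "l \<noteq> 0"
    and cont: "continuous_on ({0..1} \<times> UNIV) (\<lambda>v. poly (Q (fst v)) (snd v))"
    and bound: "\<And>\<beta> t. \<beta> \<in> {0..1} \<Longrightarrow> poly (Q \<beta>) t = 0 \<Longrightarrow> norm t \<le> R"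
    and S: "closed S" and U: "open U" "U \<subseteq> S"
    and avoid: "\<And>\<beta> t. \<beta> \<in> {0..1} \<Longrightarrow> poly (Q \<beta>) t = 0 \<Longrightarrow> t \<in> S \<Longrightarrow> t \<in> U"
    and start: "\<And>t. t \<in> S \<Longrightarrow> poly (Q 0) t \<noteq> 0"
    and t: "t \<in> S"
  shows "poly (Q 1) t \<noteq> 0"
proof -
  define Z where "Z = (\<lambda>v. poly (Q (fst v)) (snd v)) -` {0} \<inter> {0..1} \<times> (S \<inter> cball 0 R)"
  define B where "B = fst ` Z"
  have B_iff: "\<beta> \<in> B \<longleftrightarrow> \<beta> \<in> {0..1} \<and> (\<exists>t\<in>S. poly (Q \<beta>) t = 0)" for \<beta>
  proof
    assume "\<beta> \<in> {0..1} \<and> (\<exists>t\<in>S. poly (Q \<beta>) t = 0)"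
    then obtain t where "\<beta> \<in> {0..1}" "t \<in> S" "poly (Q \<beta>) t = 0" by auto
    then have "(\<beta>, t) \<in> Z" using bound[of \<beta> t] by (simp add: Z_def)
    then show "\<beta> \<in> B" unfolding B_def by (rule image_eqI[rotated]) simp
  qed (auto simp: B_def Z_def)
  have T: "compact ({0..1::real} \<times> (S \<inter> cball 0 R))"
    using S by (intro compact_Times closed_Int_compact) auto
  have "continuous_on ({0..1} \<times> (S \<inter> cball 0 R)) (\<lambda>v. poly (Q (fst v)) (snd v))"
    by (rule continuous_on_subset[OF cont]) auto
  then have "closed Z"
    unfolding Z_def using compact_imp_closed[OF T] by (intro closed_vimage_Int) auto
  moreover have "{0..1::real} \<times> (S \<inter> cball 0 R) \<inter> Z = Z" by (auto simp: Z_def)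
  ultimately have "compact Z" using compact_Int_closed[OF T] by metis
  then have "compact B" unfolding B_def by (intro compact_continuous_image continuous_intros)
  then have clo: "closedin (top_of_set {0..1}) B"
    using B_iff by (auto intro!: closed_subset compact_imp_closed)
  have op: "openin (top_of_set {0..1}) B"
  proof (subst openin_contains_ball, intro conjI ballI)
    show "B \<subseteq> {0..1}" using B_iff by auto
    fix \<beta> assume "\<beta> \<in> B"
    then obtain z where \<beta>: "\<beta> \<in> {0..1}" and z: "z \<in> S" "poly (Q \<beta>) z = 0" using B_iff by auto
    then have "z \<in> U" using avoid by blast
    then obtain \<rho> where \<rho>: "\<rho> > 0" "ball z \<rho> \<subseteq> U" using U(1) open_contains_ball by blast
    \<comment> \<open>The threshold of \<open>norm_poly_ge_root_free_ball\<close>: any parameter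
      whose polynomial is smaller than \<open>c\<close> at \<open>z\<close> has a root within
      \<open>\<rho>\<close> of \<open>z\<close>, hence in \<open>U\<close>.\<close>
    define c where "c = norm l * \<rho> ^ n"
    have "c > 0" using l \<rho> by (simp add: c_def)
    have "continuous_on {0..1} (\<lambda>\<gamma>. poly (Q \<gamma>) z)"
      using continuous_on_compose2[OF cont, of "{0..1}" "\<lambda>\<gamma>. (\<gamma>, z)"]
      by (simp add: continuous_on_Pair image_subset_iff)
    then obtain \<epsilon> where \<epsilon>: "\<epsilon> > 0"
      "\<And>\<gamma>. \<gamma> \<in> {0..1} \<Longrightarrow> dist \<gamma> \<beta> < \<epsilon> \<Longrightarrow> dist (poly (Q \<gamma>) z) (poly (Q \<beta>) z) < c"
      using \<beta> \<open>c > 0\<close> unfolding continuous_on_iff by metis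
    have "ball \<beta> \<epsilon> \<inter> {0..1} \<subseteq> B"
    proof
      fix \<gamma> assume \<gamma>: "\<gamma> \<in> ball \<beta> \<epsilon> \<inter> {0..1}"
      then have "norm (poly (Q \<gamma>) z) < c" using \<epsilon>(2)[of \<gamma>] z by (simp add: dist_commute)
      then obtain u where u: "poly (Q \<gamma>) u = 0" "dist z u < \<rho>"
        using norm_poly_ge_root_free_ball[of "Q \<gamma>" \<rho> z] Q[of \<gamma>] \<gamma> \<rho>(1)
        unfolding c_def by (metis IntD2 less_imp_le not_le)
      then show "\<gamma> \<in> B" using \<rho>(2) U(2) \<gamma> B_iff by fastforce
    qed
    then show "\<exists>e>0. ball \<beta> e \<inter> {0..1} \<subseteq> B" using \<epsilon>(1) by blast
  qed
  have "connected {0..1::real}" by simp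
  then have "B = {} \<or> B = {0..1}" using op clo connected_clopen by blast
  moreover have "0 \<notin> B" using start B_iff by auto
  ultimately have "1 \<notin> B" by auto
  then show ?thesis using t B_iff by auto
qed

lemma real_rooted_splits:
  fixes q :: "real poly"
  assumes "q \<noteq> 0" "\<And>z. poly (map_poly complex_of_real q) z = 0 \<Longrightarrow> z \<in> \<real>"
  shows "\<exists>\<mu>::nat \<Rightarrow> real. q = smult (lead_coeff q) (\<Prod>i<degree q. [:\<mu> i, 1:])"
  using assms
proof (induction "degree q" arbitrary: q)
  case 0
  then obtain c where "q = [:c:]" by (metis degree_eq_zeroE)
  then show ?case by simp
next
  case (Suc n)
  have "degree (map_poly complex_of_real q) = degree q"
    by (simp add: degree_map_poly)
  then obtain z where z: "poly (map_poly complex_of_real q) z = 0"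
    using fundamental_theorem_of_algebra[of "map_poly complex_of_real q"] constant_degree Suc.hyps(2)
    by (metis nat.distinct(1))
  then obtain r where r: "z = of_real r" using Suc.prems(2) by (meson Reals_cases)
  have "poly q r = 0" using z by (simp add: r poly_map_poly_of_real)
  then obtain k where k: "q = [:-r, 1:] * k" by (metis dvdE poly_eq_0_iff_dvd)
  have "k \<noteq> 0" using Suc.prems(1) k by auto
  then have deg: "degree q = Suc (degree k)" unfolding k by (subst degree_mult_eq) auto
  have lc: "lead_coeff q = lead_coeff k" unfolding k by (subst lead_coeff_mult) auto
  have "map_poly complex_of_real q = [:- of_real r, 1:] * map_poly complex_of_real k"
    by (rule complex_poly_eqI_real) (simp only: k poly_mult of_real_mult poly_map_poly_of_real, simp)
  then have "poly (map_poly complex_of_real q) w = 0"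
    if "poly (map_poly complex_of_real k) w = 0" for w
    using that by simp
  then obtain \<mu> where \<mu>: "k = smult (lead_coeff k) (\<Prod>i<degree k. [:\<mu> i, 1:])"
    using Suc.hyps(1)[of k] Suc.hyps(2) Suc.prems(2) deg \<open>k \<noteq> 0\<close> by auto
  have "q = smult (lead_coeff q) (\<Prod>i<degree q. [:(\<mu>(degree k := - r)) i, 1:])"
    unfolding lc unfolding deg prod.lessThan_Suc
    by (subst k, subst \<mu>) (simp add: mult.commute)
  then show ?case by blast
qed

text \<open>The extension to complex coordinates follows the inductive generation of polynomial
  functions. Polynomiality is recorded only along complex lines, which suffices because every later
  identity is reduced to a univariate one.\<close>

lemma complexification_exists:
  fixes p :: "'a::euclidean_space \<Rightarrow> real" and x y z :: 'a
  assumes "real_polynomial_function p"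
  shows "\<exists>P::complex \<Rightarrow> complex \<Rightarrow> complex \<Rightarrow> complex.
    (\<forall>a b c::real. P (of_real a) (of_real b) (of_real c)
       = of_real (p (a *\<^sub>R x + b *\<^sub>R y + c *\<^sub>R z))) \<and>
    continuous_on UNIV (\<lambda>v. P (fst v) (fst (snd v)) (snd (snd v))) \<and>
    (\<forall>a b c a' b' c'. \<exists>Q. \<forall>t. P (a + t * a') (b + t * b') (c + t * c') = poly Q t)"
  using assms
proof (induction rule: real_polynomial_function.induct)
  case (linear f)
  then interpret bounded_linear f .
  let ?P = "\<lambda>a b c. a * of_real (f x) + b * of_real (f y) + c * of_real (f z) :: complex"
  have "\<exists>Q. \<forall>t. ?P (a + t * a') (b + t * b') (c + t * c') = poly Q t" for a b c a' b' c'
    by (rule exI[of _ "[:?P a b c, ?P a' b' c':]"]) (simp add: algebra_simps)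
  then show ?case
    by (intro exI[of _ ?P]) (auto simp: add scale intro!: continuous_intros)
next
  case (const k)
  have "\<exists>Q. \<forall>t. complex_of_real k = poly Q t" by (rule exI[of _ "[:of_real k:]"]) simp
  then show ?case by (intro exI[of _ "\<lambda>a b c. of_real k"]) (auto intro!: continuous_intros)
next
  case (add f g)
  then obtain F G :: "complex \<Rightarrow> complex \<Rightarrow> complex \<Rightarrow> complex" where
    F: "\<forall>a b c::real. F (of_real a) (of_real b) (of_real c)
       = of_real (f (a *\<^sub>R x + b *\<^sub>R y + c *\<^sub>R z))"
    "continuous_on UNIV (\<lambda>v. F (fst v) (fst (snd v)) (snd (snd v)))"
    "\<forall>a b c a' b' c'. \<exists>Q. \<forall>t. F (a + t * a') (b + t * b') (c + t * c') = poly Q t" and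
    G: "\<forall>a b c::real. G (of_real a) (of_real b) (of_real c)
       = of_real (g (a *\<^sub>R x + b *\<^sub>R y + c *\<^sub>R z))"
    "continuous_on UNIV (\<lambda>v. G (fst v) (fst (snd v)) (snd (snd v)))"
    "\<forall>a b c a' b' c'. \<exists>Q. \<forall>t. G (a + t * a') (b + t * b') (c + t * c') = poly Q t"
    by (elim exE conjE) (rule that)
  have "\<exists>Q. \<forall>t. F (a + t * a') (b + t * b') (c + t * c') + G (a + t * a') (b + t * b') (c + t * c')
      = poly Q t" for a b c a' b' c'
    using F(3) G(3) by (metis poly_add)
  then show ?case using F(1,2) G(1,2)
    by (intro exI[of _ "\<lambda>a b c. F a b c + G a b c"]) (auto intro!: continuous_on_add)
next
  case (mult f g)
  then obtain F G :: "complex \<Rightarrow> complex \<Rightarrow> complex \<Rightarrow> complex" where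
    F: "\<forall>a b c::real. F (of_real a) (of_real b) (of_real c)
       = of_real (f (a *\<^sub>R x + b *\<^sub>R y + c *\<^sub>R z))"
    "continuous_on UNIV (\<lambda>v. F (fst v) (fst (snd v)) (snd (snd v)))"
    "\<forall>a b c a' b' c'. \<exists>Q. \<forall>t. F (a + t * a') (b + t * b') (c + t * c') = poly Q t" and
    G: "\<forall>a b c::real. G (of_real a) (of_real b) (of_real c)
       = of_real (g (a *\<^sub>R x + b *\<^sub>R y + c *\<^sub>R z))"
    "continuous_on UNIV (\<lambda>v. G (fst v) (fst (snd v)) (snd (snd v)))"
    "\<forall>a b c a' b' c'. \<exists>Q. \<forall>t. G (a + t * a') (b + t * b') (c + t * c') = poly Q t"
    by (elim exE conjE) (rule that)
  have "\<exists>Q. \<forall>t. F (a + t * a') (b + t * b') (c + t * c') * G (a + t * a') (b + t * b') (c + t * c')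
      = poly Q t" for a b c a' b' c'
    using F(3) G(3) by (metis poly_mult)
  then show ?case using F(1,2) G(1,2)
    by (intro exI[of _ "\<lambda>a b c. F a b c * G a b c"]) (auto intro!: continuous_on_mult)
qed

locale complexification =
  fixes d :: nat and p :: "'a::euclidean_space \<Rightarrow> real" and x y z :: 'a
    and P :: "complex \<Rightarrow> complex \<Rightarrow> complex \<Rightarrow> complex"
  assumes hom: "p (c *\<^sub>R u) = c ^ d * p u"
    and real: "P (of_real a) (of_real b) (of_real c) = of_real (p (a *\<^sub>R x + b *\<^sub>R y + c *\<^sub>R z))"
    and cont: "continuous_on UNIV (\<lambda>v. P (fst v) (fst (snd v)) (snd (snd v)))"
    and line: "\<exists>Q. \<forall>t. P (a1 + t * a2) (b1 + t * b2) (c1 + t * c2) = poly Q t"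
begin

lemma continuous_on_P:
  assumes "continuous_on S f" "continuous_on S g" "continuous_on S h"
  shows "continuous_on S (\<lambda>v. P (f v) (g v) (h v))"
  using continuous_on_compose2[OF cont continuous_on_Pair[OF assms(1) continuous_on_Pair[OF assms(2,3)]]]
  by simp

text \<open>Known for real scalars and coordinates. The scalar and then the coordinates are made
  complex one at a time, each along a complex line, where polynomials agreeing on the reals
  coincide.\<close>

lemma homogeneous: "P (l * a) (l * b) (l * c) = l ^ d * P a b c"
proof -
  have rule: "f u = g u" if "\<exists>Q. \<forall>t. f t = poly Q t" "\<exists>Q. \<forall>t. g t = poly Q t"
    "\<And>t::real. f (of_real t) = g (of_real t)" for f g :: "complex \<Rightarrow> complex" and u
    using that complex_poly_eqI_real by metis
  have mul: "\<exists>Q. \<forall>t. k * f t = poly Q t" if "\<exists>Q. \<forall>t. f t = poly Q t" for k f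
    using that by (metis poly_smult)
  have pow: "\<exists>Q. \<forall>t. t ^ d * k = poly Q t" for k :: complex
    by (rule exI[of _ "monom k d"]) (simp add: poly_monom mult.commute)
  have 1: "P (l * of_real a) (l * of_real b) (l * of_real c) =
      l ^ d * P (of_real a) (of_real b) (of_real c)" for l and a b c :: real
  proof (rule rule[where u = l])
    show "\<exists>Q. \<forall>t. P (t * of_real a) (t * of_real b) (t * of_real c) = poly Q t"
      using line[of 0 "of_real a" 0 "of_real b" 0 "of_real c"] by simp
  next
    fix t :: real
    have "p (t *\<^sub>R (a *\<^sub>R x + b *\<^sub>R y + c *\<^sub>R z)) = t ^ d * p (a *\<^sub>R x + b *\<^sub>R y + c *\<^sub>R z)"
      by (rule hom)
    then show "P (of_real t * of_real a) (of_real t * of_real b) (of_real t * of_real c) =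
      of_real t ^ d * P (of_real a) (of_real b) (of_real c)"
      by (simp add: real scaleR_add_right flip: of_real_mult of_real_power)
  qed (rule pow)
  have 2: "P (l * a) (l * of_real b) (l * of_real c) =
      l ^ d * P a (of_real b) (of_real c)" for l a and b c :: real
    by (rule rule[of "\<lambda>a. P (l * a) (l * of_real b) (l * of_real c)"
          "\<lambda>a. l ^ d * P a (of_real b) (of_real c)", OF _ mul 1])
      (use line[of 0 l "l * of_real b" 0 "l * of_real c" 0]
        line[of 0 1 "of_real b" 0 "of_real c" 0] in \<open>simp_all add: mult.commute\<close>)
  have 3: "P (l * a) (l * b) (l * of_real c) = l ^ d * P a b (of_real c)" for l a b and c :: real
    by (rule rule[of "\<lambda>b. P (l * a) (l * b) (l * of_real c)"
          "\<lambda>b. l ^ d * P a b (of_real c)", OF _ mul 2])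
      (use line[of "l * a" 0 0 l "l * of_real c" 0]
        line[of a 0 0 1 "of_real c" 0] in \<open>simp_all add: mult.commute\<close>)
  show ?thesis
    by (rule rule[of "\<lambda>c. P (l * a) (l * b) (l * c)" "\<lambda>c. l ^ d * P a b c", OF _ mul 3])
      (use line[of "l * a" 0 "l * b" 0 0 l] line[of a 0 b 0 0 1] in \<open>simp_all add: mult.commute\<close>)
qed

text \<open>By homogeneity \<open>P a t c\<close> is \<open>t ^ d\<close> times
  \<open>P (a / t) 1 (c / t)\<close>, so the leading coefficient is the value at infinity,
  \<open>P 0 1 0\<close>, which is \<open>p y\<close>. Its independence of \<open>a\<close> and
  \<open>c\<close> is what the homotopies need.\<close>

lemma poly_in_y:
  assumes "p y \<noteq> 0"
  shows "\<exists>Q. (\<forall>t. P a t c = poly Q t) \<and> degree Q = d \<and> lead_coeff Q = of_real (p y)"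
proof -
  obtain Q where Q: "\<And>t. P a t c = poly Q t" using line[of a 0 0 1 c 0] by auto
  obtain R where R: "\<And>u. P (u * a) 1 (u * c) = poly R u" using line[of 0 a 1 0 0 c] by auto
  have R0: "poly R 0 = of_real (p y)" using real[of 0 1 0] R[of 0] by simp
  then have c0: "coeff R 0 \<noteq> 0" using assms by (simp add: poly_0_coeff_0)
  then have "R \<noteq> 0" by auto
  \<comment> \<open>\<open>reflect_poly\<close> reverses \<open>R\<close> at its own degree, which
    may differ from \<open>d\<close>; the two monomials compensate for the difference.\<close>
  have "poly (monom 1 (degree R) * Q) t = poly (monom 1 d * reflect_poly R) t" if "t \<noteq> 0" for t
  proof -
    have "poly Q t = t ^ d * poly R (inverse t)"
      using homogeneous[of t "inverse t * a" 1 "inverse t * c"] that R[of "inverse t"]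
      by (simp add: Q mult.assoc[symmetric])
    then show ?thesis using that by (simp add: poly_monom poly_reflect_poly_nz)
  qed
  then have "UNIV - {0} \<subseteq> {t. poly (monom 1 (degree R) * Q - monom 1 d * reflect_poly R) t = 0}"
    by auto
  moreover have "infinite (UNIV - {0::complex})"
    using infinite_UNIV_char_0 by (simp add: infinite_remove)
  ultimately have eq: "monom 1 (degree R) * Q = monom 1 d * reflect_poly R"
    using poly_roots_finite finite_subset by (metis eq_iff_diff_eq_0)
  then have "Q \<noteq> 0" using \<open>R \<noteq> 0\<close> by auto
  have "degree (monom 1 (degree R) * Q) = degree R + degree Q"
    using \<open>Q \<noteq> 0\<close> by (simp add: degree_mult_eq degree_monom_eq)
  moreover have "degree (monom 1 d * reflect_poly R) = d + degree R"
    using \<open>R \<noteq> 0\<close> c0 by (simp add: degree_mult_eq degree_monom_eq)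
  ultimately have "degree Q = d" using eq by simp
  moreover have "lead_coeff Q = lead_coeff (reflect_poly R)"
    using arg_cong[OF eq, of lead_coeff] by (simp add: lead_coeff_mult degree_monom_eq)
  then have "lead_coeff Q = coeff R 0"
    using c0 by (simp add: coeff_reflect_poly)
  ultimately show ?thesis using Q R0 by (auto simp: poly_0_coeff_0)
qed

text \<open>A zero at \<open>(a, t, c)\<close> rescales to one at \<open>(a / t, 1, c / t)\<close>.
  For large \<open>t\<close> this is too close to \<open>(0, 1, 0)\<close>, where \<open>P\<close>
  equals \<open>p y\<close> and is nonzero nearby. The 2 in the bound accounts for the two
  coordinates \<open>a\<close> and \<open>c\<close>.\<close>

lemma roots_in_y_bounded:
  assumes "p y \<noteq> 0"
  shows "\<exists>R. \<forall>a c t. norm a \<le> M \<and> norm c \<le> M \<and> P a t c = 0 \<longrightarrow> norm t \<le> R"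
proof -
  have "P 0 1 0 \<noteq> 0" using real[of 0 1 0] assms by simp
  moreover have "continuous_on UNIV (\<lambda>v. P (fst v) 1 (snd v))"
    by (intro continuous_on_P continuous_intros)
  ultimately obtain \<delta> where \<delta>: "\<delta> > 0" "\<And>v. dist v (0, 0) < \<delta> \<Longrightarrow> P (fst v) 1 (snd v) \<noteq> 0"
    using continuous_on_avoid[of UNIV "\<lambda>v. P (fst v) 1 (snd v)" "(0, 0)" 0]
    by (metis UNIV_I dist_commute fst_conv snd_conv)
  have "norm t \<le> max 0 (2 * M / \<delta>)" if "norm a \<le> M" "norm c \<le> M" "P a t c = 0" for a c t
  proof (rule ccontr)
    assume n: "\<not> ?thesis"
    then have t: "t \<noteq> 0" by auto
    have M: "2 * M < \<delta> * norm t" using n \<delta>(1) by (simp add: not_le pos_divide_less_eq mult.commute)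
    have "P (inverse t * a) 1 (inverse t * c) = 0"
      using homogeneous[of "inverse t" a t c] that(3) t by simp
    moreover have "dist (inverse t * a, inverse t * c) (0, 0) \<le> norm a / norm t + norm c / norm t"
      using norm_Pair_le[of "inverse t * a" "inverse t * c"]
      by (simp add: dist_norm norm_mult norm_inverse norm_divide field_simps)
    moreover have "\<dots> < \<delta>" using that t M by (simp add: field_simps)
    ultimately show False using \<delta>(2) by fastforce
  qed
  then show ?thesis by blast
qed

end

subsection \<open>Garding's theorem\<close>

locale hyperbolic_poly =
  fixes d :: nat and p :: "'a::euclidean_space \<Rightarrow> real" and e :: 'a
  assumes hyp: "hyperbolic d p e"
begin

lemma poly_fun: "real_polynomial_function p"
  and hom: "p (c *\<^sub>R x) = c ^ d * p x"
  and e_pos: "0 < p e"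
  using hyp by (auto simp: hyperbolic_def homogeneous_polynomial_def)

lemma continuous_on_p: "continuous_on S p"
  using poly_fun by (intro continuous_on_polymonial_function) (simp add: real_polynomial_function_eq)

lemma real_rooted_e: "poly (map_poly complex_of_real (line_poly p x e)) z = 0 \<Longrightarrow> z \<in> \<real>"
  using hyp by (auto simp: hyperbolic_def)

text \<open>This turns out to be the interior of the hyperbolicity cone (\<open>interior_K\<close>).
  Nonvanishing along a ray is usable before convexity and openness are known; the cone itself is the
  same condition for \<open>t > 0\<close> only (\<open>K_iff\<close>).\<close>

definition C :: "'a set" where
  "C = {x. \<forall>t\<ge>0. p (x + t *\<^sub>R e) \<noteq> 0}"

lemma nonzero_C: "x \<in> C \<Longrightarrow> p x \<noteq> 0"
  unfolding C_def by force

lemma C_plus_e: "x \<in> C \<Longrightarrow> 0 \<le> t \<Longrightarrow> x + t *\<^sub>R e \<in> C"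
  unfolding C_def by (auto simp: add.assoc simp flip: scaleR_add_left)

lemma nonzero_C_combination:
  assumes "x \<in> C" "0 \<le> a" "0 \<le> b" "0 < a + b"
  shows "p (a *\<^sub>R x + b *\<^sub>R e) \<noteq> 0"
proof (cases "a = 0")
  case True
  then show ?thesis using assms e_pos hom[of b e] by simp
next
  case False
  have "p (a *\<^sub>R x + b *\<^sub>R e) = a ^ d * p (x + (b / a) *\<^sub>R e)"
    using hom[of a "x + (b / a) *\<^sub>R e"] False by (simp add: scaleR_add_right)
  moreover have "p (x + (b / a) *\<^sub>R e) \<noteq> 0" using assms by (simp add: C_def)
  ultimately show ?thesis using False by simp
qed

lemma complexification: "\<exists>P. complexification d p x y z P"
  using complexification_exists[OF poly_fun, of x y z] hom
  by (elim exE conjE, intro exI, unfold_locales) auto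

lemma real_if_P_zero:
  assumes P: "complexification d p x y e P" and z: "P (of_real a) (of_real b) c = 0"
  shows "c \<in> \<real>"
proof -
  interpret complexification d p x y e P by (rule P)
  \<comment> \<open>The factor \<open>-1\<close> matches the subtraction in
    \<open>line_poly\<close>, so \<open>c\<close> corresponds to the root
    \<open>- c\<close>.\<close>
  obtain Q where Q: "\<And>t. P (of_real a) (of_real b) (t * (-1)) = poly Q t"
    using line[of "of_real a" 0 "of_real b" 0 0 "-1"] by auto
  have "map_poly of_real (line_poly p (a *\<^sub>R x + b *\<^sub>R y) e) = Q"
  proof (rule complex_poly_eqI_real)
    fix t :: real
    have "poly Q (of_real t) = P (of_real a) (of_real b) (of_real (-t))"
      by (simp flip: Q)
    also have "\<dots> = of_real (p (a *\<^sub>R x + b *\<^sub>R y - t *\<^sub>R e))"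
      unfolding real by simp
    finally show "poly (map_poly of_real (line_poly p (a *\<^sub>R x + b *\<^sub>R y) e)) (of_real t) =
        poly Q (of_real t)"
      by (simp add: poly_map_poly_of_real poly_line_poly[OF poly_fun])
  qed
  then have "- c \<in> \<real>"
    using real_rooted_e[of "a *\<^sub>R x + b *\<^sub>R y" "- c"] z Q[of "- c"] by simp
  then show ?thesis by simp
qed

text \<open>A real root \<open>t\<close> would make the coefficient of \<open>e\<close> real by
  hyperbolicity, contradicting \<open>\<alpha> > 0\<close>; so no root crosses the real axis while
  \<open>a\<close> and \<open>c\<close> shrink to 0. At the end of the deformation a nonzero root
  satisfies \<open>\<i> * \<alpha> = r * t\<close> with \<open>p (y + r *\<^sub>R e) = 0\<close>.
  Then \<open>r < 0\<close> because \<open>y\<close> is in \<open>C\<close>, and \<open>t\<close>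
  lies in the lower half-plane.\<close>

lemma no_root_upper_half_plane_shifted:
  assumes P: "complexification d p x y e P" and y: "y \<in> C"
    and \<alpha>: "0 < \<alpha>" and t: "0 \<le> Im t"
  shows "P (of_real a) t (of_real c + \<i> * of_real \<alpha>) \<noteq> 0"
proof -
  interpret complexification d p x y e P by (rule P)
  have py: "p y \<noteq> 0" using y by (rule nonzero_C)
  have "\<forall>\<beta>::real. \<exists>Q. (\<forall>t. P (of_real (\<beta> * a)) t (of_real (\<beta> * c) + \<i> * of_real \<alpha>) = poly Q t) \<and>
      degree Q = d \<and> lead_coeff Q = of_real (p y)"
    using poly_in_y[OF py] by blast
  then obtain Q :: "real \<Rightarrow> complex poly" where
    Q: "\<And>\<beta> t. P (of_real (\<beta> * a)) t (of_real (\<beta> * c) + \<i> * of_real \<alpha>) = poly (Q \<beta>) t"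
      "\<And>\<beta>. degree (Q \<beta>) = d \<and> lead_coeff (Q \<beta>) = of_real (p y)" by metis
  obtain R where R: "\<And>a' c' t. norm a' \<le> \<bar>a\<bar> + (\<bar>c\<bar> + \<alpha>) \<Longrightarrow> norm c' \<le> \<bar>a\<bar> + (\<bar>c\<bar> + \<alpha>)
      \<Longrightarrow> P a' t c' = 0 \<Longrightarrow> norm t \<le> R"
    using roots_in_y_bounded[OF py] by metis
  have "poly (Q 1) t \<noteq> 0"
  proof (rule root_homotopy[where n = d and l = "of_real (p y)" and R = R
        and S = "{t. 0 \<le> Im t}" and U = "{t. 0 < Im t}"])
    show "degree (Q \<beta>) = d \<and> lead_coeff (Q \<beta>) = of_real (p y)" for \<beta> by (rule Q(2))
    show "continuous_on ({0..1} \<times> UNIV) (\<lambda>v. poly (Q (fst v)) (snd v))"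
      unfolding Q(1)[symmetric] by (intro continuous_on_P continuous_intros)
    show "norm t \<le> R" if \<beta>: "\<beta> \<in> {0..1}" and "poly (Q \<beta>) t = 0" for \<beta> t
    proof (rule R)
      show "P (of_real (\<beta> * a)) t (of_real (\<beta> * c) + \<i> * of_real \<alpha>) = 0" using that by (simp only: Q)
      have le: "\<bar>\<beta> * k\<bar> \<le> \<bar>k\<bar>" for k using \<beta> by (simp add: abs_mult mult_left_le_one_le)
      show "norm (complex_of_real (\<beta> * a)) \<le> \<bar>a\<bar> + (\<bar>c\<bar> + \<alpha>)"
        using le[of a] \<alpha> by (simp only: norm_of_real)
      have "norm (of_real (\<beta> * c) + \<i> * of_real \<alpha>) \<le> norm (complex_of_real (\<beta> * c)) + norm (\<i> * of_real \<alpha>)"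
        by (rule norm_triangle_ineq)
      also have "\<dots> \<le> \<bar>a\<bar> + (\<bar>c\<bar> + \<alpha>)"
        using le[of c] \<alpha> by (simp only: norm_of_real norm_mult) simp
      finally show "norm (of_real (\<beta> * c) + \<i> * of_real \<alpha>) \<le> \<bar>a\<bar> + (\<bar>c\<bar> + \<alpha>)" .
    qed
    show "t \<in> {t. 0 < Im t}" if "poly (Q \<beta>) t = 0" "t \<in> {t. 0 \<le> Im t}" for \<beta> t
    proof (rule ccontr)
      assume "t \<notin> {t. 0 < Im t}"
      then have "t = of_real (Re t)" using that by (simp add: complex_eq_iff)
      then have "of_real (\<beta> * c) + \<i> * of_real \<alpha> \<in> \<real>"
        using real_if_P_zero[OF P, of "\<beta> * a" "Re t"] that(1) by (simp only: Q)
      then show False using \<alpha> by (simp add: complex_is_Real_iff)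
    qed
    show "poly (Q 0) t \<noteq> 0" if "t \<in> {t. 0 \<le> Im t}" for t
    proof
      assume "poly (Q 0) t = 0"
      then have z: "P 0 t (\<i> * of_real \<alpha>) = 0" using Q(1)[of 0 t] by simp
      show False
      proof (cases "t = 0")
        case True
        then show False
          using z homogeneous[of "\<i> * of_real \<alpha>" 0 0 1] real[of 0 0 1] e_pos \<alpha> by simp
      next
        case False
        have z': "P (of_real 0) (of_real 1) (\<i> * of_real \<alpha> / t) = 0"
          using z homogeneous[of t 0 1 "\<i> * of_real \<alpha> / t"] False by simp
        then obtain r where r: "\<i> * of_real \<alpha> / t = of_real r"
          using real_if_P_zero[OF P, of 0 1] by (meson Reals_cases)
        then have "p (y + r *\<^sub>R e) = 0" using z' real[of 0 1 r] by simp
        then have "r < 0" using y unfolding C_def by (metis (mono_tags, lifting) mem_Collect_eq not_le)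
        have "\<i> * of_real \<alpha> = of_real r * t" using r False by (simp add: field_simps)
        then have "\<alpha> = r * Im t" by (simp add: complex_eq_iff)
        then show False using \<open>r < 0\<close> that \<alpha> by (simp add: mult_nonpos_nonneg leD)
      qed
    qed
  qed (use py t in \<open>auto simp: closed_halfspace_Im_ge open_halfspace_Im_gt\<close>)
  then show ?thesis using Q(1)[of 1 t] by simp
qed

text \<open>A Hurwitz-type limit as \<open>\<alpha>\<close> tends to 0. The shifted roots all lie
  below the real axis, at distance at least \<open>Im t\<close> from \<open>t\<close>, so the values
  at \<open>t\<close> stay above the fixed bound \<open>k\<close> and cannot tend to 0.\<close>

lemma no_root_upper_half_plane:
  assumes P: "complexification d p x y e P" and y: "y \<in> C" and t: "0 < Im t"
  shows "P (of_real a) t (of_real c) \<noteq> 0"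
proof
  interpret complexification d p x y e P by (rule P)
  assume z: "P (of_real a) t (of_real c) = 0"
  have py: "p y \<noteq> 0" using y by (rule nonzero_C)
  define k where "k = norm (complex_of_real (p y)) * Im t ^ d"
  have "k > 0" using py t by (simp add: k_def)
  have "continuous_on UNIV (\<lambda>\<alpha>::real. P (of_real a) t (of_real c + \<i> * of_real \<alpha>))"
    by (intro continuous_on_P continuous_intros)
  then obtain \<delta> where \<delta>: "\<delta> > 0" "\<And>\<alpha>::real. dist \<alpha> 0 < \<delta> \<Longrightarrow>
      dist (P (of_real a) t (of_real c + \<i> * of_real \<alpha>)) (P (of_real a) t (of_real c + \<i> * of_real 0)) < k"
    using \<open>k > 0\<close> unfolding continuous_on_iff by (metis UNIV_I)
  define \<alpha> where "\<alpha> = \<delta> / 2"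
  have "\<alpha> > 0" using \<delta>(1) by (simp add: \<alpha>_def)
  have small: "norm (P (of_real a) t (of_real c + \<i> * of_real \<alpha>)) < k"
    using \<delta>(2)[of \<alpha>] \<delta>(1) z by (simp add: \<alpha>_def)
  obtain Q where Q: "\<And>t. P (of_real a) t (of_real c + \<i> * of_real \<alpha>) = poly Q t"
    "degree Q = d" "lead_coeff Q = of_real (p y)"
    using poly_in_y[OF py] by blast
  have "Im t \<le> dist t u" if "poly Q u = 0" for u
  proof -
    have "Im u < 0"
      using no_root_upper_half_plane_shifted[OF P y \<open>\<alpha> > 0\<close>, of u a c] that Q(1) by fastforce
    then show ?thesis using abs_Im_le_cmod[of "t - u"] by (simp add: dist_norm)
  qed
  then have "k \<le> norm (poly Q t)"
    using norm_poly_ge_root_free_ball[of Q "Im t" t] t Q(2,3) by (simp add: k_def)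
  with small show False by (simp add: Q)
qed

text \<open>Negating all coordinates preserves zeros and exchanges the half-planes, so excluding the
  upper one suffices. Every \<open>y\<close> in \<open>C\<close> thereby becomes a direction of
  hyperbolicity.\<close>

lemma real_rooted_C:
  assumes P: "complexification d p x y e P" and y: "y \<in> C"
    and z: "P (of_real a) t (of_real c) = 0"
  shows "t \<in> \<real>"
proof -
  interpret complexification d p x y e P by (rule P)
  have "P (of_real (- a)) (- t) (of_real (- c)) = 0"
    using homogeneous[of "-1" "of_real a" t "of_real c"] z by simp
  then have "\<not> 0 < Im (- t)" using no_root_upper_half_plane[OF P y] by blast
  moreover have "\<not> 0 < Im t" using no_root_upper_half_plane[OF P y] z by blast
  ultimately show ?thesis by (simp add: complex_is_Real_iff)
qed

lemma linear_factors_C: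
  assumes y: "y \<in> C"
  shows "\<exists>\<mu>::nat \<Rightarrow> real. \<forall>t. p (x + t *\<^sub>R y) = p y * (\<Prod>i<d. t + \<mu> i)"
proof -
  obtain P where P: "complexification d p x y e P" using complexification by blast
  interpret complexification d p x y e P by (rule P)
  have py: "p y \<noteq> 0" using y by (rule nonzero_C)
  obtain Q where Q: "\<And>t. P 1 t 0 = poly Q t" "degree Q = d" "lead_coeff Q = of_real (p y)"
    using poly_in_y[OF py] by blast
  define q where "q = line_poly p x (- y)"
  have q: "poly q t = p (x + t *\<^sub>R y)" for t
    by (simp add: q_def poly_line_poly[OF poly_fun])
  have qQ: "map_poly of_real q = Q"
  proof (rule complex_poly_eqI_real)
    fix t :: real
    show "poly (map_poly of_real q) (of_real t) = poly Q (of_real t)"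
      using real[of 1 t 0] by (simp add: poly_map_poly_of_real q flip: Q(1))
  qed
  have deg: "degree q = d" unfolding Q(2)[symmetric] qQ[symmetric] by (simp add: degree_map_poly)
  have "lead_coeff Q = of_real (lead_coeff q)"
    unfolding qQ[symmetric] by (simp add: degree_map_poly coeff_map_poly)
  then have lc: "lead_coeff q = p y" using Q(3) by simp
  have "q \<noteq> 0" using lc py by auto
  moreover have "z \<in> \<real>" if "poly (map_poly complex_of_real q) z = 0" for z
    using real_rooted_C[OF P y, of 1 z 0] that Q(1)[of z] by (simp add: qQ)
  ultimately obtain \<mu> where \<mu>: "q = smult (lead_coeff q) (\<Prod>i<degree q. [:\<mu> i, 1:])"
    using real_rooted_splits by blast
  have "p (x + t *\<^sub>R y) = p y * (\<Prod>i<d. t + \<mu> i)" for t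
  proof -
    have "poly q t = poly (smult (p y) (\<Prod>i<d. [:\<mu> i, 1:])) t" using \<mu>[unfolded lc, unfolded deg] by (rule arg_cong)
    then show ?thesis by (simp add: q poly_prod add.commute)
  qed
  then show ?thesis by blast
qed

text \<open>Deform \<open>e\<close> into \<open>x\<close> along the segment joining them and follow
  the roots in direction \<open>y\<close>. They are all real, so a crossing of the imaginary axis
  could only be at 0, where \<open>p\<close> would vanish on that segment; this is impossible for
  \<open>x\<close> in \<open>C\<close>. At the start there is no nonnegative root since
  \<open>y\<close> is in \<open>C\<close>.\<close>

lemma nonzero_add_C:
  assumes x: "x \<in> C" and y: "y \<in> C" and t: "0 \<le> t"
  shows "p (x + t *\<^sub>R y) \<noteq> 0"
proof -
  obtain P where P: "complexification d p x y e P" using complexification by blast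
  interpret complexification d p x y e P by (rule P)
  have py: "p y \<noteq> 0" using y by (rule nonzero_C)
  have "\<forall>\<beta>::real. \<exists>Q. (\<forall>t. P (of_real \<beta>) t (of_real (1 - \<beta>)) = poly Q t) \<and>
      degree Q = d \<and> lead_coeff Q = of_real (p y)"
    using poly_in_y[OF py] by blast
  then obtain Q :: "real \<Rightarrow> complex poly" where
    Q: "\<And>\<beta> t. P (of_real \<beta>) t (of_real (1 - \<beta>)) = poly (Q \<beta>) t"
      "\<And>\<beta>. degree (Q \<beta>) = d \<and> lead_coeff (Q \<beta>) = of_real (p y)" by metis
  obtain R where R: "\<And>a' c' t. norm a' \<le> 1 \<Longrightarrow> norm c' \<le> 1 \<Longrightarrow> P a' t c' = 0 \<Longrightarrow> norm t \<le> R"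
    using roots_in_y_bounded[OF py] by metis
  have Q_real: "t = of_real (Re t) \<and> p (\<beta> *\<^sub>R x + Re t *\<^sub>R y + (1 - \<beta>) *\<^sub>R e) = 0"
    if "poly (Q \<beta>) t = 0" for \<beta> t
  proof -
    have "P (of_real \<beta>) t (of_real (1 - \<beta>)) = 0" using that by (simp only: Q)
    then have t: "t = of_real (Re t)"
      using real_rooted_C[OF P y] by (metis of_real_Re)
    then show ?thesis using that real[of \<beta> "Re t" "1 - \<beta>"] Q(1)[of \<beta> t] by simp
  qed
  have "poly (Q 1) (of_real t) \<noteq> 0"
  proof (rule root_homotopy[where n = d and l = "of_real (p y)" and R = R
        and S = "{t. 0 \<le> Re t}" and U = "{t. 0 < Re t}"])
    show "degree (Q \<beta>) = d \<and> lead_coeff (Q \<beta>) = of_real (p y)" for \<beta> by (rule Q(2))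
    show "continuous_on ({0..1} \<times> UNIV) (\<lambda>v. poly (Q (fst v)) (snd v))"
      unfolding Q(1)[symmetric] by (intro continuous_on_P continuous_intros)
    show "norm t \<le> R" if \<beta>: "\<beta> \<in> {0..1}" and "poly (Q \<beta>) t = 0" for \<beta> t
    proof (rule R)
      show "P (of_real \<beta>) t (of_real (1 - \<beta>)) = 0" using that by (simp only: Q)
      show "norm (complex_of_real (1 - \<beta>)) \<le> 1" using \<beta> by (simp only: norm_of_real) simp
    qed (use \<beta> in simp)
    show "t \<in> {t. 0 < Re t}" if \<beta>: "\<beta> \<in> {0..1}" and z: "poly (Q \<beta>) t = 0"
      and "t \<in> {t. 0 \<le> Re t}" for \<beta> t
    proof (rule ccontr)
      assume "t \<notin> {t. 0 < Re t}"
      then have "Re t = 0" using that by simp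
      then have "p (\<beta> *\<^sub>R x + (1 - \<beta>) *\<^sub>R e) = 0" using Q_real[OF z] by simp
      then show False using nonzero_C_combination[OF x, of \<beta> "1 - \<beta>"] \<beta> by simp
    qed
    show "poly (Q 0) t \<noteq> 0" if "t \<in> {t. 0 \<le> Re t}" for t
      using Q_real[of 0 t] nonzero_C_combination[OF y, of "Re t" 1] that by auto
  qed (use py t in \<open>auto simp: closed_halfspace_Re_ge open_halfspace_Re_gt\<close>)
  then show ?thesis using Q(1)[of 1 "of_real t"] real[of 1 t 0] by simp
qed

lemma C_add:
  assumes "x \<in> C" "y \<in> C"
  shows "x + y \<in> C"
  unfolding C_def
proof (intro CollectI allI impI)
  fix t :: real assume "0 \<le> t"
  then show "p (x + y + t *\<^sub>R e) \<noteq> 0"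
    using nonzero_add_C[OF C_plus_e[OF assms(1)] assms(2), of t 1] by (simp add: ac_simps)
qed

lemma C_scale:
  assumes "x \<in> C" "0 < c"
  shows "c *\<^sub>R x \<in> C"
  unfolding C_def using nonzero_C_combination[OF assms(1), of c] assms(2) by (auto simp: add_pos_nonneg)

text \<open>The \<open>\<mu> i\<close> are the eigenvalues of \<open>x\<close> relative to
  \<open>y\<close>, positive because \<open>p (x + t *\<^sub>R y)\<close> has no root
  \<open>t\<close> at or above 0. Each factor runs affinely from 1 at \<open>y\<close> to
  \<open>\<mu> i\<close> at \<open>x\<close>, which reduces concavity of \<open>ln p\<close> to that
  of \<open>ln\<close>.\<close>

lemma linear_factors_C_pos:
  assumes x: "x \<in> C" and y: "y \<in> C"
  obtains \<mu> :: "nat \<Rightarrow> real" where "\<And>i. i < d \<Longrightarrow> 0 < \<mu> i"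
    "\<And>\<tau>. p (y + \<tau> *\<^sub>R (x - y)) = p y * (\<Prod>i<d. 1 + \<tau> * (\<mu> i - 1))"
proof -
  obtain \<mu> :: "nat \<Rightarrow> real" where \<mu>: "\<And>t. p (x + t *\<^sub>R y) = p y * (\<Prod>i<d. t + \<mu> i)"
    using linear_factors_C[OF y] by blast
  have "0 < \<mu> i" if "i < d" for i
  proof (rule ccontr)
    assume "\<not> 0 < \<mu> i"
    then have "p (x + (- \<mu> i) *\<^sub>R y) \<noteq> 0" using nonzero_add_C[OF x y, of "- \<mu> i"] by simp
    moreover have "(\<Prod>j<d. - \<mu> i + \<mu> j) = 0" using that by (intro prod_zero) auto
    ultimately show False unfolding \<mu> by simp
  qed
  moreover have "p (y + \<tau> *\<^sub>R (x - y)) = p y * (\<Prod>i<d. 1 + \<tau> * (\<mu> i - 1))" for \<tau>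
  proof (cases "\<tau> = 0")
    case False
    have "\<tau> *\<^sub>R (x + ((1 - \<tau>) / \<tau>) *\<^sub>R y) = \<tau> *\<^sub>R x + (1 - \<tau>) *\<^sub>R y"
      using False by (simp add: scaleR_add_right)
    also have "\<dots> = y + \<tau> *\<^sub>R (x - y)" by (simp add: algebra_simps)
    finally have "p (y + \<tau> *\<^sub>R (x - y)) = p (\<tau> *\<^sub>R (x + ((1 - \<tau>) / \<tau>) *\<^sub>R y))"
      by simp
    also have "\<dots> = p y * (\<tau> ^ d * (\<Prod>i<d. (1 - \<tau>) / \<tau> + \<mu> i))"
      unfolding hom \<mu> by simp
    also have "\<tau> ^ d * (\<Prod>i<d. (1 - \<tau>) / \<tau> + \<mu> i) = (\<Prod>i<d. \<tau> * ((1 - \<tau>) / \<tau> + \<mu> i))"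
      by (simp add: prod.distrib)
    also have "\<dots> = (\<Prod>i<d. 1 + \<tau> * (\<mu> i - 1))"
      using False by (intro prod.cong) (auto simp: field_simps)
    finally show ?thesis .
  qed simp
  ultimately show ?thesis using that by blast
qed

section \<open>Topology of the hyperbolicity cone\<close>

lemma ball_e_subset_C: "\<exists>\<rho>>0. ball e \<rho> \<subseteq> C"
proof -
  obtain \<rho> where \<rho>: "\<rho> > 0" "\<And>z. dist e z < \<rho> \<Longrightarrow> p z \<noteq> 0"
    using continuous_on_avoid[OF continuous_on_p[of UNIV], of e 0] e_pos by auto
  have "x \<in> C" if x: "x \<in> ball e \<rho>" for x
    unfolding C_def
  proof (intro CollectI allI impI)
    fix t :: real assume t: "0 \<le> t"
    \<comment> \<open>\<open>x + t *\<^sub>R e\<close> is \<open>(1 + t) *\<^sub>R z\<close>, and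
      \<open>z\<close> lies between \<open>e\<close> and \<open>x\<close>, so one ball around
      \<open>e\<close> controls the whole ray.\<close>
    define z where "z = e + (1 / (1 + t)) *\<^sub>R (x - e)"
    have "dist e z = dist e x / (1 + t)"
      using t by (simp add: z_def dist_norm norm_minus_commute)
    also have "\<dots> \<le> dist e x" using t by (simp add: field_simps)
    finally have "p z \<noteq> 0" using \<rho>(2) x by auto
    moreover have "x + t *\<^sub>R e = (1 + t) *\<^sub>R z"
      using t by (simp add: z_def scaleR_add_right) (simp add: scaleR_add_left)
    ultimately show "p (x + t *\<^sub>R e) \<noteq> 0" using t by (simp add: hom)
  qed
  then show ?thesis using \<rho>(1) by blast
qed

lemma K_iff: "x \<in> hyperbolicity_cone p e \<longleftrightarrow> (\<forall>t>0. p (x + t *\<^sub>R e) \<noteq> 0)"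
proof -
  have "x \<in> hyperbolicity_cone p e \<longleftrightarrow> (\<forall>t<0. p (x - t *\<^sub>R e) \<noteq> 0)"
    unfolding hyperbolicity_cone_def poly_line_poly[OF poly_fun] mem_Collect_eq
    by (meson not_le)
  also have "\<dots> \<longleftrightarrow> (\<forall>t>0. p (x + t *\<^sub>R e) \<noteq> 0)"
    by (metis add_uminus_conv_diff diff_minus_eq_add neg_0_less_iff_less neg_less_0_iff_less scaleR_minus_left)
  finally show ?thesis .
qed

lemma K_plus_e: "x \<in> hyperbolicity_cone p e \<Longrightarrow> 0 < t \<Longrightarrow> x + t *\<^sub>R e \<in> C"
  unfolding C_def K_iff by (auto simp: add.assoc simp flip: scaleR_add_left)

lemma C_iff: "x \<in> C \<longleftrightarrow> x \<in> hyperbolicity_cone p e \<and> p x \<noteq> 0"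
  unfolding K_iff C_def by (auto simp: le_less)

lemma pos_C:
  assumes "x \<in> C"
  shows "0 < p x"
proof (rule ccontr)
  assume "\<not> 0 < p x"
  moreover define f where "f t = p ((1 - t) *\<^sub>R x + t *\<^sub>R e)" for t :: real
  moreover have "continuous_on {0..1} f"
    unfolding f_def by (intro continuous_on_compose2[OF continuous_on_p] continuous_intros) auto
  ultimately obtain t where "0 \<le> t" "t \<le> 1" "f t = 0"
    using IVT'[of f 0 0 1] e_pos by auto
  then show False using nonzero_C_combination[OF assms, of "1 - t" t] by (simp add: f_def)
qed

text \<open>Openness is carried over from \<open>e\<close>: moving \<open>x\<close> back by a small
  multiple of \<open>e\<close> stays in \<open>C\<close>, and adding back the scaled ball around
  \<open>e\<close> covers a neighbourhood of \<open>x\<close> by \<open>C_add\<close>.\<close>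

lemma open_C: "open C"
proof (subst open_contains_ball, intro ballI)
  fix x assume x: "x \<in> C"
  obtain \<rho> where \<rho>: "\<rho> > 0" "ball e \<rho> \<subseteq> C" using ball_e_subset_C by blast
  obtain \<delta> where \<delta>: "\<delta> > 0" "\<And>z. dist x z < \<delta> \<Longrightarrow> p z \<noteq> 0"
    using continuous_on_avoid[OF continuous_on_p[of UNIV], of x 0] nonzero_C[OF x] by auto
  define \<epsilon> where "\<epsilon> = \<delta> / (2 * (norm e + 1))"
  have pos: "norm e + 1 > 0" by (simp add: add_nonneg_pos)
  then have \<epsilon>: "\<epsilon> > 0" "\<epsilon> * norm e < \<delta>"
    using \<delta>(1) by (auto simp: \<epsilon>_def field_simps intro!: add_nonneg_pos)
  have "x - \<epsilon> *\<^sub>R e \<in> C"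
    unfolding C_def
  proof (intro CollectI allI impI)
    fix t :: real assume t: "0 \<le> t"
    show "p (x - \<epsilon> *\<^sub>R e + t *\<^sub>R e) \<noteq> 0"
    proof (cases "t \<le> \<epsilon>")
      case True
      then have "dist x (x - \<epsilon> *\<^sub>R e + t *\<^sub>R e) \<le> \<epsilon> * norm e"
        using t by (auto simp: dist_norm mult_right_mono simp flip: scaleR_diff_left)
      then show ?thesis using \<delta>(2) \<epsilon> by fastforce
    next
      case False
      then have "p (x + (t - \<epsilon>) *\<^sub>R e) \<noteq> 0" using x by (simp add: C_def)
      then show ?thesis by (simp add: algebra_simps)
    qed
  qed
  have "z \<in> C" if "z \<in> ball x (\<epsilon> * \<rho>)" for z
  proof -
    have "dist e (e + (1 / \<epsilon>) *\<^sub>R (z - x)) = dist x z / \<epsilon>"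
      using \<epsilon> by (simp add: dist_norm norm_minus_commute)
    also have "\<dots> < \<rho>" using that \<epsilon> by (simp add: field_simps)
    finally have "\<epsilon> *\<^sub>R (e + (1 / \<epsilon>) *\<^sub>R (z - x)) \<in> C" using \<rho>(2) \<epsilon> by (intro C_scale) auto
    then have "(x - \<epsilon> *\<^sub>R e) + \<epsilon> *\<^sub>R (e + (1 / \<epsilon>) *\<^sub>R (z - x)) \<in> C"
      using \<open>x - \<epsilon> *\<^sub>R e \<in> C\<close> by (intro C_add)
    then show ?thesis using \<epsilon> by (simp add: scaleR_add_right)
  qed
  then show "\<exists>r>0. ball x r \<subseteq> C" using \<epsilon> \<rho> by (intro exI[of _ "\<epsilon> * \<rho>"]) auto
qed

text \<open>Half of \<open>t *\<^sub>R e\<close> pushes a nearby point \<open>z\<close> of the cone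
  into \<open>C\<close>; the other half absorbs \<open>x - z\<close>, leaving a scaled point of the
  ball around \<open>e\<close>.\<close>

lemma closed_K: "closed (hyperbolicity_cone p e)"
proof -
  have "x \<in> hyperbolicity_cone p e" if cl: "x \<in> closure (hyperbolicity_cone p e)" for x
    unfolding K_iff
  proof (intro allI impI)
    fix t :: real assume t: "0 < t"
    obtain \<rho> where \<rho>: "\<rho> > 0" "ball e \<rho> \<subseteq> C" using ball_e_subset_C by blast
    then have "0 < t / 2 * \<rho>" using t by simp
    then obtain z where z: "z \<in> hyperbolicity_cone p e" "dist z x < t / 2 * \<rho>"
      using cl unfolding closure_approachable by blast
    have "dist e (e + (2 / t) *\<^sub>R (x - z)) = 2 / t * dist z x"
      using t by (simp add: dist_norm norm_minus_commute)
    also have "\<dots> < \<rho>" using z t by (simp add: field_simps)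
    finally have "(t / 2) *\<^sub>R (e + (2 / t) *\<^sub>R (x - z)) \<in> C" using \<rho>(2) t by (intro C_scale) auto
    then have "(z + (t / 2) *\<^sub>R e) + (t / 2) *\<^sub>R (e + (2 / t) *\<^sub>R (x - z)) \<in> C"
      using C_add[OF K_plus_e[OF z(1)]] t by simp
    also have "(z + (t / 2) *\<^sub>R e) + (t / 2) *\<^sub>R (e + (2 / t) *\<^sub>R (x - z)) = x + t *\<^sub>R e"
      using t by (simp add: scaleR_add_right flip: scaleR_add_left)
    finally show "p (x + t *\<^sub>R e) \<noteq> 0" by (rule nonzero_C)
  qed
  then show ?thesis by (metis closure_subset_eq subsetI)
qed

lemma interior_K: "interior (hyperbolicity_cone p e) = C"
proof
  show "C \<subseteq> interior (hyperbolicity_cone p e)"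
    using open_C by (intro interior_maximal) (auto simp: C_iff)
  show "interior (hyperbolicity_cone p e) \<subseteq> C"
  proof
    fix x assume "x \<in> interior (hyperbolicity_cone p e)"
    then obtain r where r: "r > 0" "ball x r \<subseteq> hyperbolicity_cone p e"
      unfolding mem_interior by blast
    define \<epsilon> where "\<epsilon> = r / (2 * (norm e + 1))"
    have pos: "norm e + 1 > 0" by (simp add: add_nonneg_pos)
    then have \<epsilon>: "\<epsilon> > 0" "\<epsilon> * norm e < r"
      using r(1) by (auto simp: \<epsilon>_def field_simps intro!: add_nonneg_pos)
    then have "x - \<epsilon> *\<^sub>R e \<in> hyperbolicity_cone p e" using r by (auto simp: dist_norm)
    from K_plus_e[OF this \<epsilon>(1)] show "x \<in> C" by simp
  qed
qed

lemma nonneg_K: "x \<in> hyperbolicity_cone p e \<Longrightarrow> 0 \<le> p x"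
  using pos_C C_iff by (metis less_imp_le order_refl)

end

subsection \<open>The conjugate barrier\<close>

text \<open>Interiority leaves room to subtract from \<open>s\<close> a functional of norm at most
  \<open>r / 2\<close> aligned with \<open>z\<close>; the result is still nonnegative at
  \<open>z\<close>.\<close>

lemma interior_dual_cone_lower_bound:
  fixes s :: "'a::euclidean_space \<Rightarrow>\<^sub>L real"
  assumes "s \<in> interior (dual_cone K)"
  obtains \<epsilon> where "0 < \<epsilon>" "\<And>z. z \<in> K \<Longrightarrow> \<epsilon> * norm z \<le> blinfun_apply s z"
proof -
  obtain r where r: "r > 0" "ball s r \<subseteq> dual_cone K" using assms unfolding mem_interior by blast
  have "r / 2 * norm z \<le> blinfun_apply s z" if z: "z \<in> K" for z
  proof (cases "z = 0")
    case False
    define h :: "'a \<Rightarrow>\<^sub>L real" where "h = (r / (2 * norm z)) *\<^sub>R blinfun_inner_right z"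
    have "norm (blinfun_inner_right z) \<le> norm z"
      by (intro norm_blinfun_bound) (simp_all add: Cauchy_Schwarz_ineq2)
    then have "norm h \<le> r / (2 * norm z) * norm z"
      unfolding h_def norm_scaleR using r(1) by (intro mult_mono) auto
    then have "s - h \<in> ball s r" using False r(1) by (simp add: dist_norm)
    then have "s - h \<in> dual_cone K" using r(2) by blast
    then have "0 \<le> blinfun_apply (s - h) z" using z by (simp add: dual_cone_def)
    moreover have "blinfun_apply h z = r / (2 * norm z) * (norm z)\<^sup>2"
      by (simp add: h_def blinfun.scaleR_left dot_square_norm)
    ultimately show ?thesis using False by (simp add: blinfun.diff_left power2_eq_square)
  qed simp
  then show ?thesis using r(1) that[of "r / 2"] by simp
qed

section \<open>Concavity of \<open>ln p\<close> along segments\<close>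

context hyperbolic_poly
begin

lemma segment_C:
  assumes "x \<in> C" "y \<in> C" "0 \<le> \<tau>" "\<tau> \<le> 1"
  shows "y + \<tau> *\<^sub>R (x - y) \<in> C"
proof -
  have eq: "y + \<tau> *\<^sub>R (x - y) = (1 - \<tau>) *\<^sub>R y + \<tau> *\<^sub>R x" by (simp add: algebra_simps)
  consider "\<tau> = 0" | "\<tau> = 1" | "0 < \<tau>" "\<tau> < 1" using assms by linarith
  then show ?thesis
  proof cases
    case 3
    then show ?thesis unfolding eq using assms by (intro C_add C_scale) auto
  qed (use assms in auto)
qed

lemma ln_p_segment:
  assumes x: "x \<in> C" and y: "y \<in> C"
  obtains \<mu> :: "nat \<Rightarrow> real" where "\<And>i. i < d \<Longrightarrow> 0 < \<mu> i"
    "\<And>\<tau>. 0 \<le> \<tau> \<Longrightarrow> \<tau> \<le> 1 \<Longrightarrow>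
      ln (p (y + \<tau> *\<^sub>R (x - y))) = ln (p y) + (\<Sum>i<d. ln (1 + \<tau> * (\<mu> i - 1)))"
    "\<And>\<tau>. p (y + \<tau> *\<^sub>R (x - y)) = p y * (\<Prod>i<d. 1 + \<tau> * (\<mu> i - 1))"
proof -
  obtain \<mu> :: "nat \<Rightarrow> real" where \<mu>: "\<And>i. i < d \<Longrightarrow> 0 < \<mu> i"
    "\<And>\<tau>. p (y + \<tau> *\<^sub>R (x - y)) = p y * (\<Prod>i<d. 1 + \<tau> * (\<mu> i - 1))"
    using linear_factors_C_pos[OF x y] by metis
  have "ln (p (y + \<tau> *\<^sub>R (x - y))) = ln (p y) + (\<Sum>i<d. ln (1 + \<tau> * (\<mu> i - 1)))"
    if \<tau>: "0 \<le> \<tau>" "\<tau> \<le> 1" for \<tau>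
  proof -
    have pos: "0 < 1 + \<tau> * (\<mu> i - 1)" if "i < d" for i
    proof (cases "\<tau> = 0")
      case False
      then have "0 < \<tau> * \<mu> i" using \<tau> \<mu>(1)[OF that] by simp
      then show ?thesis using \<tau> by (simp add: algebra_simps)
    qed simp
    then have "ln (\<Prod>i<d. 1 + \<tau> * (\<mu> i - 1)) = (\<Sum>i<d. ln (1 + \<tau> * (\<mu> i - 1)))"
      by (intro ln_prod) (use pos in fastforce)+
    moreover have "0 < (\<Prod>i<d. 1 + \<tau> * (\<mu> i - 1))" using pos by (intro prod_pos) auto
    ultimately show ?thesis unfolding \<mu>(2) using pos_C[OF y] by (metis ln_mult_pos)
  qed
  with \<mu> show ?thesis using that by blast
qed

lemma ln_p_concave:
  assumes "x \<in> C" "y \<in> C" "0 \<le> \<tau>" "\<tau> \<le> 1"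
  shows "(1 - \<tau>) * ln (p y) + \<tau> * ln (p x) \<le> ln (p (y + \<tau> *\<^sub>R (x - y)))"
proof -
  obtain \<mu> :: "nat \<Rightarrow> real" where \<mu>: "\<And>i. i < d \<Longrightarrow> 0 < \<mu> i"
    "\<And>\<tau>. 0 \<le> \<tau> \<Longrightarrow> \<tau> \<le> 1 \<Longrightarrow>
      ln (p (y + \<tau> *\<^sub>R (x - y))) = ln (p y) + (\<Sum>i<d. ln (1 + \<tau> * (\<mu> i - 1)))"
    using ln_p_segment[OF assms(1,2)] by metis
  have "\<tau> * ln (\<mu> i) \<le> ln (1 + \<tau> * (\<mu> i - 1))" if "i < d" for i
  proof -
    have "concave_on {0<..} ln" by (rule ln_concave)
    then have "(1 - \<tau>) * ln 1 + \<tau> * ln (\<mu> i) \<le> ln ((1 - \<tau>) *\<^sub>R 1 + \<tau> *\<^sub>R \<mu> i)"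
      using assms(3,4) \<mu>(1)[OF that] by (intro concave_onD) auto
    then show ?thesis by (simp add: algebra_simps)
  qed
  then have "(\<Sum>i<d. \<tau> * ln (\<mu> i)) \<le> (\<Sum>i<d. ln (1 + \<tau> * (\<mu> i - 1)))" by (intro sum_mono) auto
  moreover have "ln (p x) = ln (p y) + (\<Sum>i<d. ln (\<mu> i))" using \<mu>(2)[of 1] by simp
  ultimately show ?thesis using \<mu>(2)[OF assms(3,4)]
    by (simp add: algebra_simps sum_distrib_left)
qed

end

section \<open>The maximizer of \<open>ln p - s\<close> and the derivative of the conjugate
  barrier\<close>

locale hyperbolic_dual = hyperbolic_poly d p e
  for d and p :: "'a::euclidean_space \<Rightarrow> real" and e +
  fixes s :: "'a \<Rightarrow>\<^sub>L real"
  assumes s: "s \<in> interior (dual_cone (hyperbolicity_cone p e))"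
begin

text \<open>Exponentiating the objective makes it continuous on the closed cone, with value 0 where
  \<open>p\<close> vanishes, so compactness applies without boundary estimates. Far out, exponential
  decay beats growth of degree \<open>d\<close>; a positive maximum lies in
  \<open>C\<close>.\<close>

lemma maximizer_on_K:
  obtains y where "y \<in> C"
    "\<And>x. x \<in> hyperbolicity_cone p e \<Longrightarrow> exp (- blinfun_apply s x) * p x \<le> exp (- blinfun_apply s y) * p y"
proof -
  define g where "g x = exp (- blinfun_apply s x) * p x" for x
  let ?K = "hyperbolicity_cone p e"
  obtain \<epsilon> where \<epsilon>: "0 < \<epsilon>" "\<And>z. z \<in> ?K \<Longrightarrow> \<epsilon> * norm z \<le> blinfun_apply s z"
    using interior_dual_cone_lower_bound[OF s] by metis
  obtain \<rho> where "\<rho> > 0" "ball e \<rho> \<subseteq> C" using ball_e_subset_C by blast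
  then have "e \<in> C" by (meson centre_in_ball subsetD)
  then have e: "e \<in> ?K" "g e > 0" using e_pos by (auto simp: g_def C_iff)
  have "bounded (p ` sphere 0 1)"
    by (intro compact_imp_bounded compact_continuous_image continuous_on_p) simp
  then obtain M where M: "M > 0" "\<And>u. norm u = 1 \<Longrightarrow> p u \<le> M"
    unfolding bounded_pos by force
  have growth: "p z \<le> M * norm z ^ d" if "z \<noteq> 0" for z
  proof -
    have "p z = norm z ^ d * p ((1 / norm z) *\<^sub>R z)" using hom[of "norm z" "(1 / norm z) *\<^sub>R z"] that by simp
    also have "\<dots> \<le> norm z ^ d * M" using that by (intro mult_left_mono M(2)) auto
    finally show ?thesis by (simp add: mult.commute)
  qed
  \<comment> \<open>With \<open>r = \<epsilon> * norm z\<close>,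
    \<open>r ^ d / exp r < \<eta>\<close> says exactly that the far-field bound on
    \<open>g z\<close> is below \<open>g e\<close>.\<close>
  define \<eta> where "\<eta> = g e * \<epsilon> ^ d / M"
  have "\<eta> > 0" using e M \<epsilon> by (simp add: \<eta>_def)
  then have "eventually (\<lambda>r::real. r ^ d / exp r < \<eta>) at_top"
    using order_tendstoD(2)[OF tendsto_power_div_exp_0] by blast
  then obtain r0 where r0: "\<And>r. r \<ge> r0 \<Longrightarrow> r ^ d / exp r < \<eta>"
    unfolding eventually_at_top_linorder by blast
  define R where "R = max (norm e) (max 1 (r0 / \<epsilon>))"
  have far: "g z \<le> g e" if z: "z \<in> ?K" "norm z \<ge> R" for z
  proof -
    have nz: "z \<noteq> 0" using z by (auto simp: R_def)
    have "r0 \<le> \<epsilon> * norm z" using z \<epsilon>(1) by (simp add: R_def field_simps)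
    then have "(\<epsilon> * norm z) ^ d / exp (\<epsilon> * norm z) < \<eta>" by (rule r0)
    then have "M * norm z ^ d * exp (- (\<epsilon> * norm z)) < g e"
      using M \<epsilon> by (simp add: \<eta>_def exp_minus power_mult_distrib field_simps)
    moreover have "g z \<le> exp (- (\<epsilon> * norm z)) * (M * norm z ^ d)"
      unfolding g_def using \<epsilon>(2)[OF z(1)] growth[OF nz] nonneg_K[OF z(1)] by (intro mult_mono) auto
    ultimately show ?thesis by (simp add: mult.commute)
  qed
  have "compact (?K \<inter> cball 0 R)" using closed_K by (intro closed_Int_compact) auto
  moreover have "?K \<inter> cball 0 R \<noteq> {}" using e by (auto simp: R_def)
  moreover have "continuous_on (?K \<inter> cball 0 R) g"
    unfolding g_def by (intro continuous_intros continuous_on_p)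
  ultimately have "\<exists>y\<in>?K \<inter> cball 0 R. \<forall>z\<in>?K \<inter> cball 0 R. g z \<le> g y"
    by (rule continuous_attains_sup)
  then obtain y where y: "y \<in> ?K" "\<And>z. z \<in> ?K \<Longrightarrow> norm z \<le> R \<Longrightarrow> g z \<le> g y" by auto
  then have "g e \<le> g y" using e by (simp add: R_def)
  then have "g z \<le> g y" if "z \<in> ?K" for z
    using far[OF that] y(2)[OF that] by linarith
  moreover have "y \<in> C" using \<open>g e \<le> g y\<close> e(2) y(1) by (auto simp: C_iff g_def)
  ultimately show ?thesis using that unfolding g_def by blast
qed

definition \<psi> :: "'a \<Rightarrow> real" where "\<psi> x = ln (p x) - blinfun_apply s x"

lemma maximizer:
  obtains y where "y \<in> C" "\<And>x. x \<in> C \<Longrightarrow> \<psi> x \<le> \<psi> y"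
proof -
  obtain y where y: "y \<in> C" "\<And>x. x \<in> hyperbolicity_cone p e \<Longrightarrow>
      exp (- blinfun_apply s x) * p x \<le> exp (- blinfun_apply s y) * p y"
    using maximizer_on_K by metis
  have "\<psi> x \<le> \<psi> y" if "x \<in> C" for x
  proof -
    have "ln (exp (- blinfun_apply s x) * p x) \<le> ln (exp (- blinfun_apply s y) * p y)"
      using y(2) that pos_C[OF that] pos_C[OF y(1)] by (intro ln_mono) (auto simp: C_iff)
    then show ?thesis using pos_C[OF that] pos_C[OF y(1)] by (simp add: ln_mult \<psi>_def)
  qed
  with y(1) show ?thesis using that by blast
qed

lemma \<psi>_concave:
  assumes "x \<in> C" "y \<in> C" "0 \<le> \<tau>" "\<tau> \<le> 1"
  shows "(1 - \<tau>) * \<psi> y + \<tau> * \<psi> x \<le> \<psi> (y + \<tau> *\<^sub>R (x - y))"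
  using ln_p_concave[OF assms]
  by (simp add: \<psi>_def blinfun.add_right blinfun.scaleR_right blinfun.diff_right algebra_simps)

text \<open>On this line \<open>p\<close> is a nonzero constant, so lying in the open set
  \<open>C\<close> and in the closed cone amount to the same; the parameters in \<open>C\<close> are
  clopen, hence everything. Coercivity of \<open>s\<close>, constant on the line, then bounds the
  line.\<close>

lemma C_contains_no_s_level_line:
  assumes line: "\<And>\<tau>. p (y + \<tau> *\<^sub>R h) = p y" and y: "y \<in> C" and sh: "blinfun_apply s h = 0"
  shows "h = 0"
proof (rule ccontr)
  assume h: "h \<noteq> 0"
  let ?K = "hyperbolicity_cone p e"
  define T where "T = (\<lambda>\<tau>. y + \<tau> *\<^sub>R h) -` C"
  have "T = (\<lambda>\<tau>. y + \<tau> *\<^sub>R h) -` ?K"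
    unfolding T_def using nonzero_C[OF y] by (auto simp: C_iff line)
  then have "closed T"
    using closed_K by (auto intro!: closed_vimage continuous_intros)
  moreover have "open T"
    unfolding T_def using open_C by (intro open_vimage continuous_intros)
  moreover have "0 \<in> T" using y by (simp add: T_def)
  ultimately have "T = UNIV" using clopen by blast
  then have mem: "y + \<tau> *\<^sub>R h \<in> ?K" for \<tau> by (auto simp: T_def C_iff)
  obtain \<epsilon> where \<epsilon>: "0 < \<epsilon>" "\<And>z. z \<in> ?K \<Longrightarrow> \<epsilon> * norm z \<le> blinfun_apply s z"
    using interior_dual_cone_lower_bound[OF s] by metis
  define b where "b = blinfun_apply s y / \<epsilon>"
  have b: "norm (y + \<tau> *\<^sub>R h) \<le> b" for \<tau>
    using \<epsilon>(2)[OF mem[of \<tau>]] \<epsilon>(1) sh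
    by (simp add: b_def blinfun.add_right blinfun.scaleR_right field_simps)
  define \<tau> where "\<tau> = (b + norm y + 1) / norm h"
  have "b \<ge> 0" using b[of 0] by (metis norm_ge_zero order_trans)
  then have "norm (\<tau> *\<^sub>R h) = b + norm y + 1" using h by (simp add: \<tau>_def)
  moreover have "norm (\<tau> *\<^sub>R h) \<le> norm (y + \<tau> *\<^sub>R h) + norm y"
    using norm_triangle_ineq4[of "y + \<tau> *\<^sub>R h" y] by simp
  ultimately show False using b[of \<tau>] by simp
qed

text \<open>\<open>D i\<close> is the gain of the \<open>i\<close>-th logarithm at the midpoint over
  its mean at the endpoints. Maximality makes the sum nonpositive, while
  \<open>((1 + m) / 2)\<^sup>2 = m + ((m - 1) / 2)\<^sup>2\<close> makes each term nonnegative, with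
  equality only at \<open>m = 1\<close>. So \<open>p\<close> and \<open>s\<close> are constant along
  \<open>x - y\<close>.\<close>

lemma maximizer_unique:
  assumes y: "y \<in> C" "\<And>x. x \<in> C \<Longrightarrow> \<psi> x \<le> \<psi> y" and x: "x \<in> C" "\<psi> x = \<psi> y"
  shows "x = y"
proof -
  obtain \<mu> :: "nat \<Rightarrow> real" where \<mu>: "\<And>i. i < d \<Longrightarrow> 0 < \<mu> i"
    "\<And>\<tau>. 0 \<le> \<tau> \<Longrightarrow> \<tau> \<le> 1 \<Longrightarrow>
      ln (p (y + \<tau> *\<^sub>R (x - y))) = ln (p y) + (\<Sum>i<d. ln (1 + \<tau> * (\<mu> i - 1)))"
    "\<And>\<tau>. p (y + \<tau> *\<^sub>R (x - y)) = p y * (\<Prod>i<d. 1 + \<tau> * (\<mu> i - 1))"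
    using ln_p_segment[OF x(1) y(1)] by metis
  define h where "h = x - y"
  define D where "D i = ln ((1 + \<mu> i) / 2) - ln (\<mu> i) / 2" for i
  have "\<psi> (y + (1/2) *\<^sub>R h) \<le> \<psi> y"
    unfolding h_def using segment_C[OF x(1) y(1), of "1/2"] by (intro y(2)) simp
  moreover have "(\<Sum>i<d. ln (1 + 1/2 * (\<mu> i - 1))) = (\<Sum>i<d. ln ((1 + \<mu> i) / 2))"
    by (intro sum.cong refl arg_cong[of _ _ ln]) (simp add: field_simps)
  then have "\<psi> (y + (1/2) *\<^sub>R h) =
      ln (p y) + (\<Sum>i<d. ln ((1 + \<mu> i) / 2)) - blinfun_apply s y - blinfun_apply s h / 2"
    using \<mu>(2)[of "1/2"] unfolding \<psi>_def h_def[symmetric]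
    by (simp add: blinfun.add_right blinfun.scaleR_right)
  moreover have sh: "(\<Sum>i<d. ln (\<mu> i)) = blinfun_apply s h"
    using x(2) \<mu>(2)[of 1] by (simp add: \<psi>_def h_def blinfun.diff_right)
  ultimately have le: "(\<Sum>i<d. D i) \<le> 0"
    unfolding D_def sum_subtractf by (simp add: \<psi>_def flip: sum_divide_distrib)
  have sq: "((1 + m) / 2)\<^sup>2 = m + ((m - 1) / 2)\<^sup>2" for m :: real
    by (simp add: power2_eq_square field_simps)
  have D: "D i = (ln (\<mu> i + ((\<mu> i - 1) / 2)\<^sup>2) - ln (\<mu> i)) / 2" if "i < d" for i
  proof -
    have "ln (((1 + \<mu> i) / 2)\<^sup>2) = 2 * ln ((1 + \<mu> i) / 2)"
      using \<mu>(1)[OF that] by (simp add: ln_realpow)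
    then show ?thesis unfolding D_def sq by simp
  qed
  have D0: "0 \<le> D i" if "i < d" for i
    using \<mu>(1)[OF that] by (auto simp: D[OF that] intro!: ln_mono)
  with le have "(\<Sum>i<d. D i) = 0" by (intro antisym sum_nonneg) auto
  then have "D i = 0" if "i < d" for i
    using D0 that by (subst (asm) sum_nonneg_eq_0_iff) auto
  then have 1: "\<mu> i = 1" if "i < d" for i
  proof -
    have "ln (\<mu> i + ((\<mu> i - 1) / 2)\<^sup>2) = ln (\<mu> i)" using D[OF that] \<open>i < d \<Longrightarrow> D i = 0\<close> that by simp
    then have "((\<mu> i - 1) / 2)\<^sup>2 = 0"
      using \<mu>(1)[OF that] by (subst (asm) ln_inj_iff) (auto intro: add_pos_nonneg)
    then show ?thesis by simp
  qed
  have "p (y + \<tau> *\<^sub>R h) = p y" for \<tau>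
    unfolding h_def \<mu>(3) using 1 by simp
  moreover have "blinfun_apply s h = 0" using sh 1 by simp
  ultimately have "h = 0" using C_contains_no_s_level_line y(1) by blast
  then show ?thesis by (simp add: h_def)
qed

text \<open>Testing the supremum at \<open>y\<close> bounds it from below. From above, points within
  \<open>\<rho> \<le> \<eta>\<close> of \<open>y\<close> cost at most
  \<open>\<eta> * norm (s' - s)\<close>, and farther points lose more by concavity of
  \<open>\<psi>\<close> than a small perturbation of \<open>s\<close> can gain.\<close>

lemma conjugate_barrier_has_derivative:
  assumes y: "y \<in> C" "\<And>x. x \<in> C \<Longrightarrow> \<psi> x \<le> \<psi> y"
  shows "(conjugate_barrier (hyperbolicity_cone p e) (log_barrier p)
    has_derivative (\<lambda>k. blinfun_apply k (- y))) (at s)"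
proof -
  define G where "G = conjugate_barrier (hyperbolicity_cone p e) (log_barrier p)"
  define f where "f s' x = - blinfun_apply s' x - log_barrier p x" for s' :: "'a \<Rightarrow>\<^sub>L real" and x
  have f: "f s' x = \<psi> x - blinfun_apply (s' - s) x" for s' x
    by (simp add: f_def \<psi>_def log_barrier_def blinfun.diff_left)
  have G: "G s' = (SUP x\<in>C. f s' x)" for s'
    unfolding G_def conjugate_barrier_def interior_K f_def ..
  have key: "\<exists>\<delta>>0. \<forall>s'. norm (s' - s) < \<delta> \<longrightarrow>
      (\<forall>x\<in>C. f s' x \<le> \<psi> y - blinfun_apply (s' - s) y + \<eta> * norm (s' - s))"
    if \<eta>: "\<eta> > 0" for \<eta>
  proof -
    obtain \<rho>0 where \<rho>0: "\<rho>0 > 0" "cball y \<rho>0 \<subseteq> C"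
      using open_C y(1) open_contains_cball by blast
    define \<rho> where "\<rho> = min \<rho>0 \<eta>"
    have \<rho>: "0 < \<rho>" "\<rho> \<le> \<eta>" "sphere y \<rho> \<subseteq> C" using \<rho>0 \<eta> by (auto simp: \<rho>_def)
    have "continuous_on (sphere y \<rho>) (\<lambda>z. \<psi> y - \<psi> z)"
      unfolding \<psi>_def using \<rho>(3) nonzero_C by (intro continuous_intros continuous_on_p) auto
    then obtain u where u: "u \<in> sphere y \<rho>" "\<And>z. z \<in> sphere y \<rho> \<Longrightarrow> \<psi> y - \<psi> u \<le> \<psi> y - \<psi> z"
      using continuous_attains_inf[of "sphere y \<rho>" "\<lambda>z. \<psi> y - \<psi> z"] \<rho>(1) by auto
    \<comment> \<open>The least drop of \<open>\<psi>\<close> on the sphere, positive by uniqueness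
      of the maximizer.\<close>
    define m where "m = \<psi> y - \<psi> u"
    have "u \<noteq> y" using u(1) \<rho>(1) by auto
    then have "m > 0"
      using y maximizer_unique[OF y, of u] u(1) \<rho>(3) unfolding m_def by (smt (verit) subsetD)
    have "f s' x \<le> \<psi> y - blinfun_apply (s' - s) y + \<eta> * norm (s' - s)"
      if s': "norm (s' - s) < m / \<rho>" and x: "x \<in> C" for s' x
    proof -
      define k where "k = s' - s"
      have kx: "\<bar>blinfun_apply k (x - y)\<bar> \<le> norm k * norm (x - y)"
        using norm_blinfun[of k "x - y"] by simp
      have "\<psi> x - \<psi> y \<le> blinfun_apply k (x - y) + \<eta> * norm k"
      proof (cases "norm (x - y) \<le> \<rho>")
        case True
        then have "norm k * norm (x - y) \<le> norm k * \<eta>" using \<rho>(2) by (intro mult_left_mono) auto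
        then show ?thesis using kx y(2)[OF x] by (simp add: mult.commute)
      next
        case False
        \<comment> \<open>Scale \<open>x\<close> back to the sphere: by concavity the drop
          \<open>m\<close> there grows at least linearly, with slope \<open>m / \<rho>\<close>,
          which exceeds \<open>norm k\<close>.\<close>
        define l where "l = \<rho> / norm (x - y)"
        have n: "0 < norm (x - y)" "\<rho> < norm (x - y)" using False \<rho>(1) by linarith+
        then have l: "0 < l" "l \<le> 1" using \<rho>(1) by (simp_all add: l_def del: zero_less_norm_iff)
        have "y + l *\<^sub>R (x - y) \<in> sphere y \<rho>"
          using n \<rho>(1) by (simp add: dist_norm l_def)
        then have "m \<le> \<psi> y - \<psi> (y + l *\<^sub>R (x - y))" using u(2) unfolding m_def by blast
        also have "\<dots> \<le> l * (\<psi> y - \<psi> x)"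
          using \<psi>_concave[OF x y(1), of l] l by (simp add: algebra_simps)
        finally have "m / \<rho> * norm (x - y) \<le> \<psi> y - \<psi> x"
          using \<rho>(1) n by (simp add: l_def field_simps)
        moreover have "norm k * norm (x - y) \<le> m / \<rho> * norm (x - y)"
          using s' by (intro mult_right_mono) (auto simp: k_def)
        moreover have "0 \<le> \<eta> * norm k" using \<eta> by simp
        ultimately show ?thesis using kx by linarith
      qed
      then show ?thesis by (simp add: f k_def blinfun.diff_right)
    qed
    moreover have "m / \<rho> > 0" using \<open>m > 0\<close> \<rho>(1) by simp
    ultimately show ?thesis by blast
  qed
  have bounds: "\<psi> y - blinfun_apply (s' - s) y \<le> G s' \<and>
      G s' \<le> \<psi> y - blinfun_apply (s' - s) y + \<eta> * norm (s' - s)"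
    if "\<forall>x\<in>C. f s' x \<le> \<psi> y - blinfun_apply (s' - s) y + \<eta> * norm (s' - s)" for s' \<eta>
  proof
    \<comment> \<open>A real \<open>SUP\<close> dominates its members only for a bounded family; the
      assumed upper estimate provides the bound.\<close>
    have "bdd_above (f s' ` C)" using that by (intro bdd_aboveI2) auto
    then show "\<psi> y - blinfun_apply (s' - s) y \<le> G s'"
      unfolding G using y(1) by (subst f[symmetric], intro cSUP_upper)
    show "G s' \<le> \<psi> y - blinfun_apply (s' - s) y + \<eta> * norm (s' - s)"
      unfolding G using y(1) that by (intro cSUP_least) auto
  qed
  have Gs: "G s = \<psi> y"
  proof -
    have "\<forall>x\<in>C. f s x \<le> \<psi> y - blinfun_apply (s - s) y + 1 * norm (s - s)"
      using y(2) by (simp add: f)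
    from bounds[OF this] show ?thesis by simp
  qed
  have "(G has_derivative (\<lambda>k. blinfun_apply k (- y))) (at s)"
    unfolding has_derivative_at_alt
  proof (intro conjI allI impI)
    show "bounded_linear (\<lambda>k::'a \<Rightarrow>\<^sub>L real. blinfun_apply k (- y))"
      by (rule blinfun.bounded_linear_left)
    fix \<eta> :: real assume "0 < \<eta>"
    then obtain \<delta> where \<delta>: "\<delta> > 0" "\<And>s'. norm (s' - s) < \<delta> \<Longrightarrow>
        \<forall>x\<in>C. f s' x \<le> \<psi> y - blinfun_apply (s' - s) y + \<eta> * norm (s' - s)"
      using key by meson
    have "norm (G s' - G s - blinfun_apply (s' - s) (- y)) \<le> \<eta> * norm (s' - s)"
      if "norm (s' - s) < \<delta>" for s'
      using bounds[OF \<delta>(2)[OF that]] by (auto simp: Gs blinfun.minus_right)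
    then show "\<exists>\<delta>>0. \<forall>s'. norm (s' - s) < \<delta> \<longrightarrow>
        norm (G s' - G s - blinfun_apply (s' - s) (- y)) \<le> \<eta> * norm (s' - s)"
      using \<delta>(1) by blast
  qed
  then show ?thesis unfolding G_def .
qed

end

section \<open>Positivity of the weight on the segment, and the quadrature\<close>

theorem theorem9p1:
  fixes p :: "'a::euclidean_space \<Rightarrow> real"
    and e x xt delta :: 'a
    and \<theta> :: nat
    and K :: "'a set"
    and s :: "'a \<Rightarrow>\<^sub>L real"
    and mu :: real
  assumes "hyperbolic \<theta> p e"
    and "K = hyperbolicity_cone p e"
    and "pointed_cone K"
    and "x \<in> interior K"
    and "s \<in> interior (dual_cone K)"
    and "mu = blinfun_apply s x / real \<theta>"
    and "xt = - dual_gradient (conjugate_barrier K (log_barrier p)) s"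
    and "delta = x - mu *\<^sub>R xt"
  shows "\<exists>r w :: nat \<Rightarrow> real.
           (\<forall>i\<in>{1..\<theta>}. r i \<in> {0..1}) \<and>
           (\<forall>q :: real poly. degree q < 2 * \<theta> \<longrightarrow>
              ((\<lambda>t. poly q t / (p (x - t *\<^sub>R delta))\<^sup>2) has_integral
                 (\<Sum>i=1..\<theta>. w i * poly q (r i))) {0..1})"
proof (cases "\<theta> = 0")
  case False
  interpret hyperbolic_dual \<theta> p e s
    using assms by unfold_locales auto
  have x: "x \<in> C" using assms(2,4) interior_K by simp
  obtain y where y: "y \<in> C" "\<And>x. x \<in> C \<Longrightarrow> \<psi> x \<le> \<psi> y" using maximizer by metis
  have "dual_gradient (conjugate_barrier K (log_barrier p)) s = - y"
    unfolding assms(2) by (rule dual_gradient_eq[OF conjugate_barrier_has_derivative[OF y]])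
  then have xt: "xt = y" by (simp add: assms(7))
  obtain \<epsilon> where \<epsilon>: "0 < \<epsilon>" "\<And>z. z \<in> K \<Longrightarrow> \<epsilon> * norm z \<le> blinfun_apply s z"
    using interior_dual_cone_lower_bound[OF assms(5)] by metis
  \<comment> \<open>Positive degree keeps the origin out of \<open>C\<close>, so \<open>x\<close> is
    nonzero and coercivity of \<open>s\<close> gives \<open>mu > 0\<close>; scaling by
    \<open>mu\<close> then preserves \<open>C\<close>.\<close>
  have "p 0 = 0" using hom[of 0 0] False by (simp add: power_0_left)
  then have "x \<noteq> 0" using nonzero_C[OF x] by auto
  then have "0 < \<epsilon> * norm x" using \<epsilon>(1) by simp
  also have "\<dots> \<le> blinfun_apply s x" using \<epsilon>(2) x assms(2) by (simp add: C_iff)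
  finally have "0 < mu" using False by (simp add: assms(6))
  then have "mu *\<^sub>R y \<in> C" using y(1) by (intro C_scale)
  then have mem: "x - t *\<^sub>R delta \<in> C" if "t \<in> {0..1}" for t
    using segment_C[OF _ x, of "mu *\<^sub>R y" t] that unfolding assms(8) xt by (simp add: algebra_simps)
  have "continuous_on {0..1} (\<lambda>t. 1 / (p (x - t *\<^sub>R delta))\<^sup>2)"
    using mem nonzero_C
    by (intro continuous_intros continuous_on_compose2[OF continuous_on_p[of UNIV]]) auto
  moreover have "0 < 1 / (p (x - t *\<^sub>R delta))\<^sup>2" if "t \<in> {0..1}" for t
    using nonzero_C[OF mem[OF that]] by simp
  ultimately show ?thesis
    using weighted_integral_quadrature[of 0 1 "\<lambda>t. 1 / (p (x - t *\<^sub>R delta))\<^sup>2" \<theta>] by simp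
qed simp

end
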